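(* Let $L$ be a solvable finite-dimensional Lie algebra over a field $F$. Then the prefrattini subalgebras of $L$ are precisely the subalgebras of the form $\bigcap_{j} K_j$, where $C_j/R_j$ runs over the distinct crowns of $L$ and, for each $j$, $K_j$ is a subalgebra of $L$ with $R_j \subseteq K_j$ such that $K_j/R_j$ is a complement of $C_j/R_j$ in $L/R_j$ (one complement being taken from each crown).
   Context: A chief factor of $L$ is $A/B$ with $B\subsetneq A$ ideals and no ideal strictly between; $C_L(A/B) = \{x : [x,A]\subseteq B\}$. $\phi(X)$ is the largest ideal of $X$ contained in the intersection of all maximal subalgebras of $X$; $A/B$ is a Frattini chief factor if $A/B\subseteq\phi(L/B)$. A subalgebra $M$ supplements $A/B$ if $L = A+M$ and $B\subseteq A\cap M$. The core $M_L$ is the largest ideal of $L$ in $M$; $L$ is primitive if some maximal subalgebra has zero core; monolithic if it has a unique minimal ideal; primitive of type 3 if it has exactly two distinct minimal ideals, both non-abelian. Chief factors are $L$-connected if they are isomorphic as $L$-modules or there is an ideal $N$ with $L/N$ primitive of type 3 whose two minimal ideals are $L$-isomorphic to them respectively. The crown associated with a supplemented chief factor $A/B$ is $C/R$ with $C = A + C_L(A/B)$ and $R$ the intersection of all $M_L$, $M$ a maximal subalgebra with $L/M_L$ monolithic and primitive supplementing a chief factor $L$-connected to $A/B$; the crowns of $L$ are the crowns associated with its supplemented chief factors. Prefrattini subalgebras: fix a chief series $0 = L_0 \subset L_1 \subset \cdots \subset L_n = L$; let $\mathcal{I}$ be the set of $i$ such that $L_i/L_{i-1}$ is not a Frattini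 chief factor, and for $i\in\mathcal{I}$ let $\mathcal{M}_i$ be the set of maximal subalgebras $M$ of $L$ with $L_{i-1}\subseteq M$ and $L_i\not\subseteq M$. A subalgebra $B$ is prefrattini if $B = \bigcap_{i\in\mathcal{I}} M_i$ for some choice of $M_i \in \mathcal{M}_i$ (this family does not depend on the chosen chief series). *)

theory Defs
  imports Main "HOL.Vector_Spaces"
begin

locale lie_algebra = vector_space scale
  for scale :: "'f::field \<Rightarrow> 'v::ab_group_add \<Rightarrow> 'v" +
  fixes br :: "'v \<Rightarrow> 'v \<Rightarrow> 'v"
  assumes br_add_left: "br (x + y) z = br x z + br y z"
    and br_add_right: "br x (y + z) = br x y + br x z"
    and br_scale_left: "br (scale a x) y = scale a (br x y)"
    and br_scale_right: "br x (scale a y) = scale a (br x y)"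
    and br_alt: "br x x = 0"
    and jacobi: "br x (br y z) + br y (br z x) + br z (br x y) = 0"
begin

definition fin_dim :: bool where
  "fin_dim \<longleftrightarrow> (\<exists>B. finite B \<and> span B = UNIV)"

definition lsum :: "'v set \<Rightarrow> 'v set \<Rightarrow> 'v set" where
  "lsum A B = {a + b | a b. a \<in> A \<and> b \<in> B}"

definition subalg :: "'v set \<Rightarrow> bool" where
  "subalg S \<longleftrightarrow> subspace S \<and> (\<forall>x\<in>S. \<forall>y\<in>S. br x y \<in> S)"

definition lie_ideal :: "'v set \<Rightarrow> bool" where
  "lie_ideal I \<longleftrightarrow> subspace I \<and> (\<forall>x. \<forall>y\<in>I. br x y \<in> I)"

fun derived :: "nat \<Rightarrow> 'v set" where
  "derived 0 = UNIV"
| "derived (Suc n) = span {br x y | x y. x \<in> derived n \<and> y \<in> derived n}"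

definition solvable :: bool where
  "solvable \<longleftrightarrow> (\<exists>n. derived n = {0})"

definition maximal_subalg :: "'v set \<Rightarrow> bool" where
  "maximal_subalg M \<longleftrightarrow> subalg M \<and> M \<noteq> UNIV \<and>
     (\<forall>S. subalg S \<and> M \<subseteq> S \<longrightarrow> S = M \<or> S = UNIV)"

definition chief_factor :: "'v set \<Rightarrow> 'v set \<Rightarrow> bool" where
  "chief_factor A B \<longleftrightarrow> lie_ideal A \<and> lie_ideal B \<and> B \<subset> A \<and>
     (\<forall>I. lie_ideal I \<and> B \<subseteq> I \<and> I \<subseteq> A \<longrightarrow> I = B \<or> I = A)"

definition centr :: "'v set \<Rightarrow> 'v set \<Rightarrow> 'v set" where
  "centr A B = {x. \<forall>a\<in>A. br x a \<in> B}"

definition core :: "'v set \<Rightarrow> 'v set" where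
  "core M = (THE I. lie_ideal I \<and> I \<subseteq> M \<and> (\<forall>J. lie_ideal J \<and> J \<subseteq> M \<longrightarrow> J \<subseteq> I))"

text \<open>phi(L/B), described through the correspondence between ideals/subalgebras of L/B and
  ideals/subalgebras of L containing B: the largest ideal I of L with B \<subseteq> I and I contained
  in every maximal subalgebra of L containing B.  A/B \<subseteq> phi(L/B) is then A \<subseteq> I.\<close>
definition frattini_factor :: "'v set \<Rightarrow> 'v set \<Rightarrow> bool" where
  "frattini_factor A B \<longleftrightarrow> (\<exists>I. lie_ideal I \<and> B \<subseteq> I \<and>
      I \<subseteq> \<Inter>{M. maximal_subalg M \<and> B \<subseteq> M} \<and>
      (\<forall>J. lie_ideal J \<and> B \<subseteq> J \<and> J \<subseteq> \<Inter>{M. maximal_subalg M \<and> B \<subseteq> M} \<longrightarrow> J \<subseteq> I) \<and>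
      A \<subseteq> I)"

definition supplements :: "'v set \<Rightarrow> 'v set \<Rightarrow> 'v set \<Rightarrow> bool" where
  "supplements M A B \<longleftrightarrow> subalg M \<and> lsum A M = UNIV \<and> B \<subseteq> A \<inter> M"

definition supplemented :: "'v set \<Rightarrow> 'v set \<Rightarrow> bool" where
  "supplemented A B \<longleftrightarrow> (\<exists>M. supplements M A B)"

text \<open>Isomorphism of L-modules A/B \<cong> A'/B', expressed via a linear map g : A \<rightarrow> A' with
  g(B) \<subseteq> B' inducing a bijective L-equivariant map A/B \<rightarrow> A'/B' (every linear map between
  the quotients lifts to such a g).\<close>
definition module_iso :: "'v set \<Rightarrow> 'v set \<Rightarrow> 'v set \<Rightarrow> 'v set \<Rightarrow> bool" where
  "module_iso A B A' B' \<longleftrightarrow> (\<exists>g. (\<forall>a\<in>A. g a \<in> A') \<and>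
     (\<forall>a\<in>A. \<forall>b\<in>A. g (a + b) = g a + g b) \<and>
     (\<forall>c. \<forall>a\<in>A. g (scale c a) = scale c (g a)) \<and>
     (\<forall>a\<in>A. g a \<in> B' \<longleftrightarrow> a \<in> B) \<and>
     (\<forall>a'\<in>A'. \<exists>a\<in>A. g a - a' \<in> B') \<and>
     (\<forall>x. \<forall>a\<in>A. g (br x a) - br x (g a) \<in> B'))"

text \<open>Minimal ideals of L/N correspond to ideals I of L minimal with N \<subset> I.\<close>
definition minimal_ideal_mod :: "'v set \<Rightarrow> 'v set \<Rightarrow> bool" where
  "minimal_ideal_mod N I \<longleftrightarrow> lie_ideal I \<and> N \<subset> I \<and>
     (\<forall>J. lie_ideal J \<and> N \<subset> J \<and> J \<subseteq> I \<longrightarrow> J = I)"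

text \<open>L/N primitive: some maximal subalgebra of L/N has zero core, i.e. some maximal
  subalgebra M of L containing N has core N.\<close>
definition primitive_mod :: "'v set \<Rightarrow> bool" where
  "primitive_mod N \<longleftrightarrow> (\<exists>M. maximal_subalg M \<and> N \<subseteq> M \<and> core M = N)"

definition monolithic_mod :: "'v set \<Rightarrow> bool" where
  "monolithic_mod N \<longleftrightarrow> (\<exists>!I. minimal_ideal_mod N I)"

definition nonabelian_mod :: "'v set \<Rightarrow> 'v set \<Rightarrow> bool" where
  "nonabelian_mod N I \<longleftrightarrow> \<not> (\<forall>x\<in>I. \<forall>y\<in>I. br x y \<in> N)"

definition primitive_type3_mod :: "'v set \<Rightarrow> 'v set \<Rightarrow> 'v set \<Rightarrow> bool" where
  "primitive_type3_mod N I1 I2 \<longleftrightarrow> lie_ideal N \<and> primitive_mod N \<and> I1 \<noteq> I2 \<and>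
     {I. minimal_ideal_mod N I} = {I1, I2} \<and>
     nonabelian_mod N I1 \<and> nonabelian_mod N I2"

definition connected :: "'v set \<Rightarrow> 'v set \<Rightarrow> 'v set \<Rightarrow> 'v set \<Rightarrow> bool" where
  "connected A B A' B' \<longleftrightarrow> module_iso A B A' B' \<or>
     (\<exists>N I1 I2. primitive_type3_mod N I1 I2 \<and>
        module_iso I1 N A B \<and> module_iso I2 N A' B')"

definition crown_top :: "'v set \<Rightarrow> 'v set \<Rightarrow> 'v set" where
  "crown_top A B = lsum A (centr A B)"

definition crown_bot :: "'v set \<Rightarrow> 'v set \<Rightarrow> 'v set" where
  "crown_bot A B = \<Inter>{core M | M. maximal_subalg M \<and> monolithic_mod (core M) \<and>
       primitive_mod (core M) \<and>
       (\<exists>A' B'. chief_factor A' B' \<and> connected A' B' A B \<and> supplements M A' B')}"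

definition crowns :: "('v set \<times> 'v set) set" where
  "crowns = {(crown_top A B, crown_bot A B) | A B. chief_factor A B \<and> supplemented A B}"

definition chief_series :: "(nat \<Rightarrow> 'v set) \<Rightarrow> nat \<Rightarrow> bool" where
  "chief_series Ls n \<longleftrightarrow> Ls 0 = {0} \<and> Ls n = UNIV \<and>
     (\<forall>i\<in>{1..n}. chief_factor (Ls i) (Ls (i - 1)))"

definition prefrattini :: "'v set \<Rightarrow> bool" where
  "prefrattini U \<longleftrightarrow> (\<exists>Ls n. chief_series Ls n \<and>
     (\<exists>Ms. (\<forall>i\<in>{i\<in>{1..n}. \<not> frattini_factor (Ls i) (Ls (i - 1))}.
               maximal_subalg (Ms i) \<and> Ls (i - 1) \<subseteq> Ms i \<and> \<not> Ls i \<subseteq> Ms i) \<and>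
            U = (\<Inter>i\<in>{i\<in>{1..n}. \<not> frattini_factor (Ls i) (Ls (i - 1))}. Ms i)))"

text \<open>K/R is a complement of C/R in L/R (with R \<subseteq> K): K/R + C/R = L/R and
  K/R \<inter> C/R = 0.\<close>
definition complement_mod :: "'v set \<Rightarrow> 'v set \<Rightarrow> 'v set \<Rightarrow> bool" where
  "complement_mod K C R \<longleftrightarrow> subalg K \<and> R \<subseteq> K \<and> lsum K C = UNIV \<and>
     (\<forall>x\<in>K. (\<exists>c\<in>C. x - c \<in> R) \<longrightarrow> x \<in> R)"

end

end

theory Submission
  imports Defs
begin

text \<open>In a solvable algebra chief factors are abelian, so a maximal subalgebra M supplementing a chief
  factor A/B meets C = C_L(A/B) exactly in its core, and C / core M is isomorphic to A/B.  Hence R is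
  the intersection of the C \<inter> M over all M belonging to the isomorphism type of A/B.  Fix a chief
  series and one maximal subalgebra for each non-Frattini factor of this type, and let K be
  their intersection.  Descending the series gives K + C = L, and C \<inter> K = R: an M not containing
  C \<inter> K can be exchanged for another one that contains a longer initial part of the
  series, until M = L.  Grouping a prefrattini subalgebra by crowns thus gives complements; conversely,
  a given complement K arises from the maximal subalgebras core M + K.

  Since L supplements everything, a chief factor with no maximal supplement in its isomorphism type
  also has a crown; its R is the empty intersection L, so its only complement is L.\<close>

context lie_algebra
begin

section \<open>The bracket calculus, sums of ideals and subalgebras, cores\<close>

lemma br_0_left [simp]: "br 0 x = 0"
  using br_add_left[of 0 0 x] by simp

lemma br_0_right [simp]: "br x 0 = 0"
  using br_add_right[of x 0 0] by simp

lemma br_skew: "br x y = - br y x"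
proof -
  have "br (x + y) (x + y) = 0" by (rule br_alt)
  then have "br x y + br y x = 0"
    unfolding br_add_left br_add_right by (simp add: br_alt add.commute)
  then show ?thesis by (simp add: eq_neg_iff_add_eq_0)
qed

lemma br_minus_right: "br x (- y) = - br x y"
  using br_add_right[of x y "- y"] by (simp add: eq_neg_iff_add_eq_0 add.commute)

lemma br_diff_right: "br x (y - z) = br x y - br x z"
  using br_add_right[of x y "- z"] by (simp add: br_minus_right)

text \<open>The Jacobi identity in the form that ad \<open>z\<close> is a derivation; this is what
  makes centralisers and \<open>[A,A]\<close> ideals.\<close>

lemma br_br: "br z (br x y) = br (br z x) y + br x (br z y)"
proof -
  have "br z (br x y) = - br x (br y z) - br y (br z x)"
    using jacobi[of x y z] by (simp add: algebra_simps eq_neg_iff_add_eq_0)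
  also have "br x (br y z) = - br x (br z y)"
    using br_skew[of y z] by (simp add: br_minus_right)
  also have "br y (br z x) = - br (br z x) y"
    by (rule br_skew)
  finally show ?thesis by simp
qed

lemma subalg_subspace: "subalg S \<Longrightarrow> subspace S"
  and subalg_br: "subalg S \<Longrightarrow> x \<in> S \<Longrightarrow> y \<in> S \<Longrightarrow> br x y \<in> S"
  by (simp_all add: subalg_def)

lemma ideal_subspace: "lie_ideal I \<Longrightarrow> subspace I"
  and ideal_br: "lie_ideal I \<Longrightarrow> y \<in> I \<Longrightarrow> br x y \<in> I"
  by (simp_all add: lie_ideal_def)

lemma ideal_br_left: "lie_ideal I \<Longrightarrow> y \<in> I \<Longrightarrow> br y x \<in> I"
  using br_skew[of y x] by (metis ideal_br ideal_subspace subspace_neg)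

lemma ideal_Int: "lie_ideal I \<Longrightarrow> lie_ideal J \<Longrightarrow> lie_ideal (I \<inter> J)"
  by (simp add: lie_ideal_def subspace_inter)

lemma subalg_Int: "subalg S \<Longrightarrow> subalg T \<Longrightarrow> subalg (S \<inter> T)"
  by (simp add: subalg_def subspace_inter)

lemma lsumI: "a \<in> A \<Longrightarrow> b \<in> B \<Longrightarrow> a + b \<in> lsum A B"
  by (auto simp: lsum_def)

lemma lsumE:
  assumes "x \<in> lsum A B"
  obtains a b where "a \<in> A" "b \<in> B" "x = a + b"
  using assms by (auto simp: lsum_def)

lemma lsum_commute: "lsum A B = lsum B A"
proof -
  have "lsum X Y \<subseteq> lsum Y X" for X Y
    by (auto elim!: lsumE) (subst add.commute, erule (1) lsumI[rotated])
  then show ?thesis by blast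
qed

lemma lsum_left: "subspace B \<Longrightarrow> A \<subseteq> lsum A B"
  using lsumI[of _ A 0 B] by (auto simp: subspace_0)

lemma lsum_right: "subspace A \<Longrightarrow> B \<subseteq> lsum A B"
  using lsumI[of 0 A _ B] by (auto simp: subspace_0)

lemma lsum_least: "subspace S \<Longrightarrow> A \<subseteq> S \<Longrightarrow> B \<subseteq> S \<Longrightarrow> lsum A B \<subseteq> S"
  by (auto elim!: lsumE intro: subspace_add)

lemma lsum_mono: "A \<subseteq> A' \<Longrightarrow> B \<subseteq> B' \<Longrightarrow> lsum A B \<subseteq> lsum A' B'"
  by (auto elim!: lsumE intro: lsumI)

lemma subspace_lsum: "subspace A \<Longrightarrow> subspace B \<Longrightarrow> subspace (lsum A B)"
  unfolding lsum_def by (rule subspace_sums)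

text \<open>The Dedekind law: if \<open>x = a + m\<close> lies in \<open>C\<close>, then so does
  \<open>m = x - a\<close>.\<close>

lemma lsum_modular:
  assumes "subspace C" "A \<subseteq> C"
  shows "C \<inter> lsum A M = lsum A (C \<inter> M)"
proof
  show "C \<inter> lsum A M \<subseteq> lsum A (C \<inter> M)"
  proof
    fix x assume x: "x \<in> C \<inter> lsum A M"
    then obtain a m where am: "a \<in> A" "m \<in> M" "x = a + m" by (auto elim: lsumE)
    with x assms have "x - a \<in> C" by (blast intro: subspace_diff)
    with am have "m \<in> C \<inter> M" by simp
    with am show "x \<in> lsum A (C \<inter> M)" by (auto intro: lsumI)
  qed
  show "lsum A (C \<inter> M) \<subseteq> C \<inter> lsum A M"
    using assms lsum_least[of C A "C \<inter> M"] lsum_mono[of A A "C \<inter> M" M] by blast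
qed

lemma ideal_lsum:
  assumes "lie_ideal I" "lie_ideal J"
  shows "lie_ideal (lsum I J)"
  unfolding lie_ideal_def
proof (intro conjI allI ballI)
  show "subspace (lsum I J)"
    using assms by (simp add: subspace_lsum ideal_subspace)
  fix x y assume "y \<in> lsum I J"
  then obtain a b where "a \<in> I" "b \<in> J" "y = a + b" by (rule lsumE)
  then show "br x y \<in> lsum I J"
    using assms by (simp add: br_add_right lsumI ideal_br)
qed

lemma subalg_lsum:
  assumes "lie_ideal I" "subalg S"
  shows "subalg (lsum I S)"
  unfolding subalg_def
proof (intro conjI ballI)
  show "subspace (lsum I S)"
    using assms by (simp add: subspace_lsum ideal_subspace subalg_subspace)
  fix x y assume "x \<in> lsum I S" "y \<in> lsum I S"
  then obtain a s b t where *: "a \<in> I" "s \<in> S" "x = a + s" "b \<in> I" "t \<in> S" "y = b + t"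
    by (auto elim!: lsumE)
  have "br x y = (br a (b + t) + br s b) + br s t"
    using * by (simp add: br_add_left br_add_right)
  moreover have "br a (b + t) + br s b \<in> I"
    using * assms by (blast intro: subspace_add ideal_subspace ideal_br ideal_br_left)
  moreover have "br s t \<in> S" using * assms by (blast intro: subalg_br)
  ultimately show "br x y \<in> lsum I S" by (auto intro: lsumI)
qed

text \<open>The union of all ideals inside \<open>S\<close> is stable under every
  \<open>br x\<close>, so its span is again an ideal. This supplies both cores and the ideal in the
  definition of a Frattini chief factor.\<close>

lemma subspace_largest_ideal:
  assumes "subspace S"
  obtains I where "lie_ideal I" "I \<subseteq> S" "\<And>J. lie_ideal J \<Longrightarrow> J \<subseteq> S \<Longrightarrow> J \<subseteq> I"
proof -
  define X where "X = \<Union>{J. lie_ideal J \<and> J \<subseteq> S}"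
  have "lie_ideal (span X)"
    unfolding lie_ideal_def
  proof (intro conjI allI ballI)
    fix x y assume "y \<in> span X"
    then show "br x y \<in> span X"
    proof (induction rule: span_induct_alt)
      case base then show ?case by (simp add: span_zero)
    next
      case (step c b z)
      then have "br x b \<in> X" unfolding X_def using ideal_br by blast
      with step show ?case
        by (auto simp: br_add_right br_scale_right intro: span_add span_scale span_base)
    qed
  qed simp
  moreover have "span X \<subseteq> S" using assms unfolding X_def by (intro span_minimal) auto
  moreover have "J \<subseteq> span X" if "lie_ideal J" "J \<subseteq> S" for J
    using that span_superset[of X] unfolding X_def by blast
  ultimately show ?thesis by (rule that)
qed

text \<open>Two largest ideals contain each other, so the definite description in
  \<open>core\<close> is legitimate.\<close>

lemma core_properties:
  assumes "subspace M"
  shows core_ideal: "lie_ideal (core M)"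
    and core_subset: "core M \<subseteq> M"
    and core_greatest: "lie_ideal J \<Longrightarrow> J \<subseteq> M \<Longrightarrow> J \<subseteq> core M"
proof -
  have "\<exists>!I. lie_ideal I \<and> I \<subseteq> M \<and> (\<forall>J. lie_ideal J \<and> J \<subseteq> M \<longrightarrow> J \<subseteq> I)"
    by (rule subspace_largest_ideal[OF assms]) (metis subset_antisym)
  from theI'[OF this]
  have *: "lie_ideal (core M) \<and> core M \<subseteq> M \<and> (\<forall>J. lie_ideal J \<and> J \<subseteq> M \<longrightarrow> J \<subseteq> core M)"
    unfolding core_def .
  show "lie_ideal (core M)" "core M \<subseteq> M" using * by blast+
  show "J \<subseteq> core M" if "lie_ideal J" "J \<subseteq> M" using * that by blast
qed

section \<open>Maximal subalgebras and chief factors\<close>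

lemma maximal_subalg_subalg: "maximal_subalg M \<Longrightarrow> subalg M"
  and maximal_subalg_neq_UNIV: "maximal_subalg M \<Longrightarrow> M \<noteq> UNIV"
  by (simp_all add: maximal_subalg_def)

lemma maximal_subalg_subspace: "maximal_subalg M \<Longrightarrow> subspace M"
  by (simp add: maximal_subalg_subalg subalg_subspace)

lemma maximal_subalg_lsum_ideal:
  assumes "maximal_subalg M" "lie_ideal I" "\<not> I \<subseteq> M"
  shows "lsum I M = UNIV"
proof -
  have "M \<subseteq> lsum I M" "I \<subseteq> lsum I M"
    using assms by (auto intro!: lsum_left lsum_right dest: ideal_subspace
        maximal_subalg_subspace simp del: subset_iff)
  moreover have "subalg (lsum I M)"
    using assms by (intro subalg_lsum maximal_subalg_subalg)
  ultimately show ?thesis using assms unfolding maximal_subalg_def by blast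
qed

lemma
  assumes "chief_factor A B"
  shows chief_factor_ideal_top: "lie_ideal A"
    and chief_factor_ideal_bot: "lie_ideal B"
    and chief_factor_subset: "B \<subset> A"
    and chief_factor_between: "lie_ideal I \<Longrightarrow> B \<subseteq> I \<Longrightarrow> I \<subseteq> A \<Longrightarrow> I = B \<or> I = A"
  using assms by (auto simp: chief_factor_def)

lemma chief_factor_lsum:
  assumes "chief_factor A B" "lie_ideal I" "I \<subseteq> A" "\<not> I \<subseteq> B"
  shows "lsum I B = A"
proof -
  have sub: "subspace A" "subspace B" "subspace I"
    using assms chief_factor_ideal_top chief_factor_ideal_bot ideal_subspace by blast+
  have "lsum I B = B \<or> lsum I B = A"
    using assms sub chief_factor_subset[OF assms(1)]
    by (intro chief_factor_between[OF assms(1)] ideal_lsum lsum_right lsum_least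
        chief_factor_ideal_bot[OF assms(1)]) auto
  moreover have "I \<subseteq> lsum I B" using sub by (intro lsum_left)
  ultimately show ?thesis using assms by blast
qed

text \<open>The lattice half of the second isomorphism theorem: adding \<open>Y\<close> and
  intersecting with \<open>X\<close> are mutually inverse between the ideals from
  \<open>X \<inter> Y\<close> to \<open>X\<close> and those from \<open>Y\<close> to
  \<open>X + Y\<close>, by the modular law.\<close>

lemma chief_factor_diamond:
  assumes "lie_ideal X" "lie_ideal Y"
  shows "chief_factor (lsum X Y) Y \<longleftrightarrow> chief_factor X (X \<inter> Y)"
proof -
  have sX: "subspace X" and sY: "subspace Y" using assms by (auto dest: ideal_subspace)
  have iS: "lie_ideal (lsum X Y)" and iI: "lie_ideal (X \<inter> Y)"
    using assms by (simp_all add: ideal_lsum ideal_Int)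
  have X: "X \<subseteq> lsum X Y" and Y: "Y \<subseteq> lsum X Y"
    using lsum_left[OF sY] lsum_right[OF sX] by auto
  show ?thesis
  proof
    assume ch: "chief_factor (lsum X Y) Y"
    show "chief_factor X (X \<inter> Y)"
      unfolding chief_factor_def
    proof (intro conjI allI impI assms iI)
      show "X \<inter> Y \<subset> X"
        using chief_factor_subset[OF ch] lsum_least[OF sY, of X Y] by blast
      fix I assume I: "lie_ideal I \<and> X \<inter> Y \<subseteq> I \<and> I \<subseteq> X"
      have "X \<inter> lsum I Y = lsum I (X \<inter> Y)" using I by (intro lsum_modular sX) auto
      also have "\<dots> = I"
        using I lsum_least[of I I "X \<inter> Y"] lsum_left[OF ideal_subspace[OF iI], of I]
        by (auto dest: ideal_subspace)
      finally have *: "X \<inter> lsum I Y = I" .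
      have "lsum I Y = Y \<or> lsum I Y = lsum X Y"
        using I assms by (intro chief_factor_between[OF ch] ideal_lsum lsum_right lsum_mono)
          (auto dest: ideal_subspace)
      with * X show "I = X \<inter> Y \<or> I = X" by blast
    qed
  next
    assume ch: "chief_factor X (X \<inter> Y)"
    show "chief_factor (lsum X Y) Y"
      unfolding chief_factor_def
    proof (intro conjI allI impI assms iS)
      show "Y \<subset> lsum X Y" using chief_factor_subset[OF ch] X Y by blast
      fix I assume I: "lie_ideal I \<and> Y \<subseteq> I \<and> I \<subseteq> lsum X Y"
      have "I \<inter> lsum Y X = lsum Y (I \<inter> X)"
        using I by (intro lsum_modular) (auto dest: ideal_subspace)
      with I have eq: "I = lsum (I \<inter> X) Y" by (metis lsum_commute inf.absorb1)
      have "I \<inter> X = X \<inter> Y \<or> I \<inter> X = X"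
        using I assms by (intro chief_factor_between[OF ch] ideal_Int) auto
      then show "I = Y \<or> I = lsum X Y"
      proof
        assume "I \<inter> X = X \<inter> Y"
        then have "I \<subseteq> Y" using eq lsum_least[OF sY, of "I \<inter> X" Y] by blast
        then show ?thesis using I by blast
      next
        assume "I \<inter> X = X"
        then show ?thesis using eq by simp
      qed
    qed
  qed
qed

section \<open>Isomorphisms between factors as L-modules\<close>

lemma module_iso_diamond:
  assumes "subspace X" "subspace Y" "lie_ideal Y"
  shows "module_iso X (X \<inter> Y) (lsum X Y) Y"
  unfolding module_iso_def
\<comment> \<open>The inclusion of \<open>X\<close> into \<open>X + Y\<close> lifts the second
  isomorphism; \<open>x + y\<close> is congruent to \<open>x\<close> modulo
  \<open>Y\<close>.\<close>
proof (intro exI[of _ "\<lambda>x. x"] conjI ballI allI)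
  show "a \<in> lsum X Y" if "a \<in> X" for a using that lsum_left[OF assms(2)] by blast
  show "\<exists>a\<in>X. a - a' \<in> Y" if "a' \<in> lsum X Y" for a'
  proof -
    from that obtain x y where "x \<in> X" "y \<in> Y" "a' = x + y" by (rule lsumE)
    then show ?thesis using subspace_neg[OF assms(2)] by (intro bexI[of _ x]) auto
  qed
qed (auto simp: subspace_0[OF assms(2)])

lemma module_isoE:
  assumes "module_iso A B A' B'"
  obtains g where "\<And>a. a \<in> A \<Longrightarrow> g a \<in> A'"
    "\<And>a b. a \<in> A \<Longrightarrow> b \<in> A \<Longrightarrow> g (a + b) = g a + g b"
    "\<And>c a. a \<in> A \<Longrightarrow> g (scale c a) = scale c (g a)"
    "\<And>a. a \<in> A \<Longrightarrow> g a \<in> B' \<longleftrightarrow> a \<in> B"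
    "\<And>a'. a' \<in> A' \<Longrightarrow> \<exists>a\<in>A. g a - a' \<in> B'"
    "\<And>x a. a \<in> A \<Longrightarrow> g (br x a) - br x (g a) \<in> B'"
  using assms unfolding module_iso_def by blast

lemma module_iso_trans:
  assumes 1: "module_iso A B A' B'" and 2: "module_iso A' B' A'' B''"
    and ideals: "lie_ideal A" "lie_ideal A'" "lie_ideal B'" "lie_ideal B''" "B' \<subseteq> A'"
  shows "module_iso A B A'' B''"
proof -
  obtain g where g: "\<And>a. a \<in> A \<Longrightarrow> g a \<in> A'"
    "\<And>a b. a \<in> A \<Longrightarrow> b \<in> A \<Longrightarrow> g (a + b) = g a + g b"
    "\<And>c a. a \<in> A \<Longrightarrow> g (scale c a) = scale c (g a)"
    "\<And>a. a \<in> A \<Longrightarrow> g a \<in> B' \<longleftrightarrow> a \<in> B"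
    "\<And>a'. a' \<in> A' \<Longrightarrow> \<exists>a\<in>A. g a - a' \<in> B'"
    "\<And>x a. a \<in> A \<Longrightarrow> g (br x a) - br x (g a) \<in> B'"
    by (rule module_isoE[OF 1]) (rule that)
  obtain h where h: "\<And>a. a \<in> A' \<Longrightarrow> h a \<in> A''"
    "\<And>a b. a \<in> A' \<Longrightarrow> b \<in> A' \<Longrightarrow> h (a + b) = h a + h b"
    "\<And>c a. a \<in> A' \<Longrightarrow> h (scale c a) = scale c (h a)"
    "\<And>a. a \<in> A' \<Longrightarrow> h a \<in> B'' \<longleftrightarrow> a \<in> B'"
    "\<And>a'. a' \<in> A'' \<Longrightarrow> \<exists>a\<in>A'. h a - a' \<in> B''"
    "\<And>x a. a \<in> A' \<Longrightarrow> h (br x a) - br x (h a) \<in> B''"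
    by (rule module_isoE[OF 2]) (rule that)
  \<comment> \<open>The lift \<open>h\<close> has to respect congruence modulo \<open>B'\<close>
    before surjectivity and equivariance can pass to the composite.\<close>
  have diff: "h u - h v \<in> B''" if "u \<in> A'" "v \<in> A'" "u - v \<in> B'" for u v
  proof -
    have uv: "u - v \<in> A'" using that ideals by blast
    have "h u = h ((u - v) + v)" by simp
    also have "\<dots> = h (u - v) + h v" using h(2)[OF uv that(2)] .
    finally show ?thesis using h(4)[OF uv] that by simp
  qed
  show ?thesis
    unfolding module_iso_def
  proof (intro exI[of _ "\<lambda>x. h (g x)"] conjI ballI allI)
    show "\<exists>a\<in>A. h (g a) - a'' \<in> B''" if a'': "a'' \<in> A''" for a''
    proof -
      obtain a' where a': "a' \<in> A'" "h a' - a'' \<in> B''" using h(5)[OF a''] by blast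
      obtain a where a: "a \<in> A" "g a - a' \<in> B'" using g(5)[OF a'(1)] by blast
      have "(h (g a) - h a') + (h a' - a'') \<in> B''"
        using diff a a' g(1) ideals(4) by (blast intro: subspace_add ideal_subspace)
      then show ?thesis using a by auto
    qed
    show "h (g (br x a)) - br x (h (g a)) \<in> B''" if "a \<in> A" for x a
    proof -
      have "h (g (br x a)) - h (br x (g a)) \<in> B''"
        using that g ideals by (intro diff) (auto intro: ideal_br)
      moreover have "h (br x (g a)) - br x (h (g a)) \<in> B''" using that g h by blast
      ultimately have "(h (g (br x a)) - h (br x (g a))) + (h (br x (g a)) - br x (h (g a))) \<in> B''"
        using ideals(4) by (blast intro: subspace_add ideal_subspace)
      then show ?thesis by simp
    qed
  qed (simp_all add: g h)
qed

text \<open>The inverse must be lifted to a linear map on \<open>A'\<close>, and an arbitrary choice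
  of preimages need not be linear. Preimages are therefore chosen on a basis \<open>E\<close> of
  \<open>A'\<close> and extended linearly.\<close>

lemma module_iso_sym:
  assumes "module_iso A B A' B'"
    and ideals: "lie_ideal A" "lie_ideal A'" "lie_ideal B'"
  shows "module_iso A' B' A B"
proof -
  obtain g where g: "\<And>a. a \<in> A \<Longrightarrow> g a \<in> A'"
    "\<And>a b. a \<in> A \<Longrightarrow> b \<in> A \<Longrightarrow> g (a + b) = g a + g b"
    "\<And>c a. a \<in> A \<Longrightarrow> g (scale c a) = scale c (g a)"
    "\<And>a. a \<in> A \<Longrightarrow> g a \<in> B' \<longleftrightarrow> a \<in> B"
    "\<And>a'. a' \<in> A' \<Longrightarrow> \<exists>a\<in>A. g a - a' \<in> B'"
    "\<And>x a. a \<in> A \<Longrightarrow> g (br x a) - br x (g a) \<in> B'"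
    by (rule module_isoE[OF assms(1)]) (rule that)
  have sA: "subspace A" and sA': "subspace A'" and sB': "subspace B'"
    using ideals by (auto dest: ideal_subspace)
  have g_diff: "g (a - b) = g a - g b" if "a \<in> A" "b \<in> A" for a b
  proof -
    have "g ((a - b) + b) = g (a - b) + g b" using that sA by (intro g(2) subspace_diff)
    then show ?thesis by simp
  qed
  have g_0: "g 0 = 0" using g_diff[of 0 0] subspace_0[OF sA] by simp
  obtain E where E: "E \<subseteq> A'" "independent E" "A' \<subseteq> span E"
    using maximal_independent_subset by blast
  obtain s where s: "\<And>e. e \<in> E \<Longrightarrow> s e \<in> A \<and> g (s e) - e \<in> B'"
    using E(1) g(5) by (metis subsetD)
  interpret vector_space_pair scale scale ..
  obtain h where h: "Vector_Spaces.linear scale scale h" "\<And>e. e \<in> E \<Longrightarrow> h e = s e"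
    using linear_independent_extend[OF E(2), of s] by blast
  interpret h: Vector_Spaces.linear scale scale h by (rule h(1))
  \<comment> \<open>The map \<open>h\<close> is a right inverse of \<open>g\<close> modulo
    \<open>B'\<close> on all of \<open>A'\<close>. The induction also keeps \<open>h a\<close>
    inside \<open>A\<close>, where alone \<open>g\<close> is known to be additive.\<close>
  have key: "h a \<in> A \<and> g (h a) - a \<in> B'" if "a \<in> A'" for a
  proof -
    have "a \<in> span E" using that E by blast
    then show ?thesis
    proof (induction rule: span_induct_alt)
      case base
      then show ?case by (simp add: h.zero g_0 sA sB' subspace_0)
    next
      case (step c b y)
      have b: "h b \<in> A" "g (h b) - b \<in> B'" using s[OF step(1)] h(2)[OF step(1)] by auto
      have y: "h y \<in> A" "g (h y) - y \<in> B'" using step(2) by auto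
      have hb: "scale c (h b) \<in> A" using b sA by (intro subspace_scale)
      have "h (scale c b + y) \<in> A" unfolding h.add h.scale
        using hb y sA by (intro subspace_add)
      moreover have "g (h (scale c b + y)) - (scale c b + y)
          = scale c (g (h b) - b) + (g (h y) - y)"
        unfolding h.add h.scale using g(2)[OF hb y(1)] g(3)[OF b(1)]
        by (simp add: scale_right_diff_distrib)
      moreover have "scale c (g (h b) - b) + (g (h y) - y) \<in> B'"
        using b y sB' by (intro subspace_add subspace_scale)
      ultimately show ?case by (simp only: simp_thms)
    qed
  qed
  show ?thesis
    unfolding module_iso_def
  proof (intro exI[of _ h] conjI ballI allI)
    show "h (a + b) = h a + h b" for a b by (rule h.add)
    show "h (scale c a) = scale c (h a)" for c a by (rule h.scale)
    show "h a \<in> A" if "a \<in> A'" for a using key that by blast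
    show "h a \<in> B \<longleftrightarrow> a \<in> B'" if "a \<in> A'" for a
    proof -
      have "h a \<in> B \<longleftrightarrow> g (h a) \<in> B'" using key[OF that] g(4) by blast
      also have "\<dots> \<longleftrightarrow> a \<in> B'"
        using key[OF that] sB' by (metis diff_add_cancel subspace_add subspace_diff diff_diff_eq2 add_diff_cancel_left')
      finally show ?thesis .
    qed
    show "\<exists>a\<in>A'. h a - b \<in> B" if "b \<in> A" for b
    proof
      show "g b \<in> A'" using g that by blast
      have k: "h (g b) \<in> A" "g (h (g b)) - g b \<in> B'" using key g that by blast+
      then have "g (h (g b) - b) \<in> B'" using g_diff that by simp
      then show "h (g b) - b \<in> B" using g(4) k that sA by (blast intro: subspace_diff)
    qed
    \<comment> \<open>Membership in \<open>B\<close> is tested by applying \<open>g\<close>, since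
      an element of \<open>A\<close> lies in \<open>B\<close> exactly when its image lies in
      \<open>B'\<close>.\<close>
    show "h (br x a) - br x (h a) \<in> B" if a: "a \<in> A'" for x a
    proof -
      have k: "h (br x a) \<in> A" "g (h (br x a)) - br x a \<in> B'" "h a \<in> A" "g (h a) - a \<in> B'"
        using key a ideals(2) by (blast intro: ideal_br)+
      have x: "br x (h a) \<in> A" using k ideals(1) by (blast intro: ideal_br)
      have "g (h (br x a) - br x (h a)) =
          (g (h (br x a)) - br x a) - br x (g (h a) - a) - (g (br x (h a)) - br x (g (h a)))"
        using g_diff[OF k(1) x] by (simp add: br_diff_right)
      also have "\<dots> \<in> B'"
        by (rule subspace_diff[OF sB' subspace_diff[OF sB' k(2) ideal_br[OF ideals(3) k(4)]]
            g(6)[OF k(3)]])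
      finally show ?thesis using g(4) k(1) x sA by (blast intro: subspace_diff)
    qed
  qed
qed

section \<open>Centralisers, Frattini factors, supplements and complements\<close>

lemma ideal_centr:
  assumes "lie_ideal A" "lie_ideal B"
  shows "lie_ideal (centr A B)"
proof -
  have "subspace (centr A B)"
    using ideal_subspace[OF assms(2)]
    by (auto simp: centr_def subspace_def br_add_left br_scale_left)
  moreover have "br x y \<in> centr A B" if "y \<in> centr A B" for x y
    unfolding centr_def
  proof safe
    fix a assume a: "a \<in> A"
    have "br (br x y) a = br x (br y a) - br y (br x a)"
      using br_br[of x y a] by simp
    moreover have "br x (br y a) \<in> B" "br y (br x a) \<in> B"
      using that a assms unfolding centr_def by (auto intro: ideal_br)
    ultimately show "br (br x y) a \<in> B"
      using ideal_subspace[OF assms(2)] by (simp add: subspace_diff)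
  qed
  ultimately show ?thesis by (simp add: lie_ideal_def)
qed

text \<open>Isomorphic modules have the same annihilator: \<open>br x a\<close> lies in
  \<open>B\<close> exactly when \<open>br x (g a)\<close> lies in \<open>B'\<close>, and
  \<open>g\<close> meets every coset of \<open>B'\<close> in \<open>A'\<close>.\<close>

lemma module_iso_centr:
  assumes "module_iso A B A' B'" "lie_ideal A" "lie_ideal A'" "lie_ideal B'"
  shows "centr A B = centr A' B'"
proof -
  obtain g where g: "\<And>a. a \<in> A \<Longrightarrow> g a \<in> A'"
    "\<And>a. a \<in> A \<Longrightarrow> g a \<in> B' \<longleftrightarrow> a \<in> B"
    "\<And>a'. a' \<in> A' \<Longrightarrow> \<exists>a\<in>A. g a - a' \<in> B'"
    "\<And>x a. a \<in> A \<Longrightarrow> g (br x a) - br x (g a) \<in> B'"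
    by (rule module_isoE[OF assms(1)]) (rule that)
  have sB': "subspace B'" using assms ideal_subspace by blast
  have cong: "u \<in> B' \<longleftrightarrow> v \<in> B'" if "u - v \<in> B'" for u v
    using that sB' by (metis add_diff_cancel_left' diff_add_cancel subspace_add subspace_diff diff_diff_eq2)
  have *: "br x a \<in> B \<longleftrightarrow> br x (g a) \<in> B'" if "a \<in> A" for x a
    using g(2)[of "br x a"] cong[OF g(4)[OF that]] assms(2) that by (simp add: ideal_br)
  show ?thesis
  proof
    show "centr A' B' \<subseteq> centr A B" using * g(1) by (auto simp: centr_def)
    show "centr A B \<subseteq> centr A' B'"
      unfolding centr_def
    proof safe
      fix x a' assume x: "\<forall>a\<in>A. br x a \<in> B" and a': "a' \<in> A'"
      obtain a where a: "a \<in> A" "g a - a' \<in> B'" using g(3)[OF a'] by blast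
      have "br x (g a) - br x a' \<in> B'"
        using ideal_br[OF assms(4) a(2), of x] by (simp add: br_diff_right)
      then show "br x a' \<in> B'" using cong x a * by blast
    qed
  qed
qed

text \<open>As \<open>A\<close> is an ideal, it lies in the largest ideal inside the intersection of
  the maximal subalgebras over \<open>B\<close> iff it lies in that intersection. So the
  non-Frattini factors are exactly those for which a maximal subalgebra can be chosen in
  \<open>prefrattini\<close>.\<close>

lemma not_frattini_factor_iff:
  assumes "chief_factor A B"
  shows "\<not> frattini_factor A B \<longleftrightarrow> (\<exists>M. maximal_subalg M \<and> B \<subseteq> M \<and> \<not> A \<subseteq> M)"
proof
  let ?S = "\<Inter>{M. maximal_subalg M \<and> B \<subseteq> M}"
  have "subspace ?S" by (intro subspace_Inter) (auto dest: maximal_subalg_subspace)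
  then obtain I where I: "lie_ideal I" "I \<subseteq> ?S" "\<And>J. lie_ideal J \<Longrightarrow> J \<subseteq> ?S \<Longrightarrow> J \<subseteq> I"
    by (rule subspace_largest_ideal) blast
  assume nf: "\<not> frattini_factor A B"
  show "\<exists>M. maximal_subalg M \<and> B \<subseteq> M \<and> \<not> A \<subseteq> M"
  proof (rule ccontr)
    assume "\<not> ?thesis"
    then have "A \<subseteq> ?S" by blast
    then have "A \<subseteq> I" "B \<subseteq> I"
      using I(3)[of A] assms unfolding chief_factor_def by auto
    then have "frattini_factor A B"
      unfolding frattini_factor_def using I by (intro exI[of _ I]) auto
    with nf show False by simp
  qed
next
  assume "\<exists>M. maximal_subalg M \<and> B \<subseteq> M \<and> \<not> A \<subseteq> M"
  then show "\<not> frattini_factor A B" unfolding frattini_factor_def by blast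
qed

lemma supplements_iff_maximal:
  assumes "chief_factor A B" "maximal_subalg M"
  shows "supplements M A B \<longleftrightarrow> B \<subseteq> M \<and> \<not> A \<subseteq> M"
proof
  assume s: "supplements M A B"
  have "\<not> A \<subseteq> M"
  proof
    assume "A \<subseteq> M"
    then have "lsum A M \<subseteq> M" using maximal_subalg_subspace[OF assms(2)] by (intro lsum_least) auto
    with s show False using maximal_subalg_neq_UNIV[OF assms(2)] by (auto simp: supplements_def)
  qed
  with s show "B \<subseteq> M \<and> \<not> A \<subseteq> M" by (auto simp: supplements_def)
next
  assume "B \<subseteq> M \<and> \<not> A \<subseteq> M"
  then show "supplements M A B"
    using assms maximal_subalg_lsum_ideal[OF assms(2) chief_factor_ideal_top[OF assms(1)]]
      chief_factor_subset[OF assms(1)] maximal_subalg_subalg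
    by (auto simp: supplements_def)
qed

lemma module_iso_refl: "subspace B \<Longrightarrow> module_iso A B A B"
  unfolding module_iso_def by (intro exI[of _ "\<lambda>x. x"]) (auto simp: subspace_0, metis diff_self subspace_0)

text \<open>For \<open>x = k + c\<close> in \<open>K'\<close>, the summand \<open>c\<close> lies in
  \<open>K' \<inter> C\<close>, hence in \<open>R\<close> and so in \<open>K\<close>. Later this
  reduces an equality of complements to one inclusion.\<close>

lemma complement_mod_unique:
  assumes "complement_mod K C R" "complement_mod K' C R" "K \<subseteq> K'" "subspace R"
  shows "K = K'"
proof
  show "K' \<subseteq> K"
  proof
    fix x assume x: "x \<in> K'"
    have "x \<in> lsum K C" using assms(1) by (simp add: complement_mod_def)
    then obtain k c where kc: "k \<in> K" "c \<in> C" "x = k + c" by (rule lsumE)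
    have "subspace K'" using assms(2) by (simp add: complement_mod_def subalg_subspace)
    then have "x - k \<in> K'" using x kc assms(3) by (blast intro: subspace_diff)
    then have "c \<in> K'" using kc by simp
    moreover have "c - c \<in> R" using subspace_0[OF assms(4)] by simp
    ultimately have "c \<in> R" using assms(2) kc(2) unfolding complement_mod_def by blast
    then have "c \<in> K" using assms(1) unfolding complement_mod_def by blast
    then show "x \<in> K"
      using kc assms(1) by (auto simp: complement_mod_def dest: subalg_subspace intro: subspace_add)
  qed
qed (rule assms(3))

lemma monolithic_mod_unique:
  assumes "monolithic_mod N" "chief_factor A N" "chief_factor A' N"
  shows "A = A'"
proof -
  have "minimal_ideal_mod N A" "minimal_ideal_mod N A'"
    using assms(2,3) unfolding minimal_ideal_mod_def chief_factor_def by blast+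
  then show ?thesis using assms(1) unfolding monolithic_mod_def by blast
qed

lemma chief_series_mono:
  assumes "chief_series Ls n" "i \<le> j" "j \<le> n"
  shows "Ls i \<subseteq> Ls j"
  using assms(2,3)
proof (induction j rule: dec_induct)
  case (step j)
  have "chief_factor (Ls (Suc j)) (Ls j)"
    using assms(1) step.prems unfolding chief_series_def by (metis atLeastAtMost_iff diff_Suc_1 le_add1 plus_1_eq_Suc)
  with step show ?case by (auto dest: chief_factor_subset)
qed simp

end

section \<open>Solvable algebras: chief factors and their maximal supplements\<close>

locale solvable_lie_algebra = lie_algebra +
  assumes finite_dim: fin_dim and solv: solvable
begin

text \<open>If \<open>[A,A]\<close> were not inside \<open>B\<close>, then
  \<open>A = [A,A] + B\<close>. Iterating this places \<open>A\<close> in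
  \<open>B + derived n\<close> for every \<open>n\<close>, and solvability reduces the sum to
  \<open>B\<close>.\<close>

lemma chief_factor_abelian:
  assumes ch: "chief_factor A B" and "x \<in> A" "y \<in> A"
  shows "br x y \<in> B"
proof (rule ccontr)
  assume "br x y \<notin> B"
  note iA = chief_factor_ideal_top[OF ch] and iB = chief_factor_ideal_bot[OF ch]
  have sA: "subspace A" and sB: "subspace B" using iA iB by (auto dest: ideal_subspace)
  \<comment> \<open>This is \<open>[A,A]\<close>, an ideal because ad \<open>z\<close> is a
    derivation preserving \<open>A\<close>.\<close>
  define D where "D = span {br u v | u v. u \<in> A \<and> v \<in> A}"
  have iD: "lie_ideal D"
    unfolding lie_ideal_def
  proof (intro conjI allI ballI)
    show "subspace D" by (simp add: D_def)
    fix z w assume "w \<in> D"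
    then show "br z w \<in> D"
      unfolding D_def
    proof (induction rule: span_induct_alt)
      case base then show ?case by (simp add: span_zero)
    next
      case (step c b w)
      then obtain u v where uv: "b = br u v" "u \<in> A" "v \<in> A" by blast
      have "br (br z u) v \<in> span {br u v | u v. u \<in> A \<and> v \<in> A}"
        "br u (br z v) \<in> span {br u v | u v. u \<in> A \<and> v \<in> A}"
        using uv iA by (blast intro: span_base ideal_br)+
      then have "br z b \<in> span {br u v | u v. u \<in> A \<and> v \<in> A}"
        unfolding uv(1) br_br[of z u v] by (rule span_add)
      with step(2) show ?case unfolding br_add_right br_scale_right
        by (intro span_add span_scale)
    qed
  qed
  have "D \<subseteq> A"
    unfolding D_def using sA iA by (intro span_minimal) (auto intro: ideal_br)
  moreover have "br x y \<in> D" unfolding D_def using assms by (blast intro: span_base)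
  ultimately have A: "lsum D B = A"
    using \<open>br x y \<notin> B\<close> by (intro chief_factor_lsum[OF ch iD]) auto
  have "A \<subseteq> lsum B (derived n)" for n
  proof (induction n)
    case 0
    have "x \<in> lsum B UNIV" for x using lsumI[of 0 B x UNIV] sB by (simp add: subspace_0)
    then show ?case by auto
  next
    case (Suc n)
    have sD: "subspace (derived (Suc n))" by simp
    \<comment> \<open>Modulo the ideal \<open>B\<close>, only the bracket of the
      \<open>derived n\<close> parts survives.\<close>
    have "{br u v | u v. u \<in> A \<and> v \<in> A} \<subseteq> lsum B (derived (Suc n))"
    proof clarify
      fix u v assume "u \<in> A" "v \<in> A"
      then have "u \<in> lsum B (derived n)" "v \<in> lsum B (derived n)" using Suc by auto
      then obtain a d b e where *: "a \<in> B" "d \<in> derived n" "u = a + d"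
        "b \<in> B" "e \<in> derived n" "v = b + e" by (auto elim!: lsumE)
      have "br u v = (br a v + br d b) + br d e" using * by (simp add: br_add_left br_add_right)
      moreover have "br a v + br d b \<in> B"
        using * iB sB by (intro subspace_add) (auto intro: ideal_br ideal_br_left)
      moreover have "br d e \<in> derived (Suc n)" using * by (auto intro: span_base)
      ultimately show "br u v \<in> lsum B (derived (Suc n))" by (metis lsumI)
    qed
    then have "D \<subseteq> lsum B (derived (Suc n))"
      unfolding D_def using sB sD by (intro span_minimal subspace_lsum)
    moreover have "B \<subseteq> lsum B (derived (Suc n))" using sD by (rule lsum_left)
    ultimately show ?case
      using A lsum_least[OF subspace_lsum[OF sB sD]] by blast
  qed
  moreover obtain n where "derived n = {0}" using solv by (auto simp: solvable_def)
  ultimately have "A \<subseteq> B" by (force elim: lsumE)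
  then show False using chief_factor_subset[OF ch] by blast
qed

lemma chief_factor_subset_centr: "chief_factor A B \<Longrightarrow> A \<subseteq> centr A B"
  using chief_factor_abelian by (auto simp: centr_def)

lemma chief_factor_ideal_centr: "chief_factor A B \<Longrightarrow> lie_ideal (centr A B)"
  by (intro ideal_centr chief_factor_ideal_top chief_factor_ideal_bot)

lemma crown_top_eq:
  assumes "chief_factor A B"
  shows "crown_top A B = centr A B"
  unfolding crown_top_def
proof
  have s: "subspace A" "subspace (centr A B)"
    using chief_factor_ideal_top[OF assms] chief_factor_ideal_centr[OF assms]
    by (auto dest: ideal_subspace)
  show "lsum A (centr A B) \<subseteq> centr A B"
    using s chief_factor_subset_centr[OF assms] by (intro lsum_least) auto
  show "centr A B \<subseteq> lsum A (centr A B)" using s by (intro lsum_right)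
qed

lemma module_iso_chief_sym:
  "module_iso A B A' B' \<Longrightarrow> chief_factor A B \<Longrightarrow> chief_factor A' B' \<Longrightarrow> module_iso A' B' A B"
  by (rule module_iso_sym) (assumption | erule chief_factor_ideal_top chief_factor_ideal_bot
      psubset_imp_subset[OF chief_factor_subset])+

lemma module_iso_chief_trans:
  "module_iso A B A' B' \<Longrightarrow> module_iso A' B' A'' B'' \<Longrightarrow>
    chief_factor A B \<Longrightarrow> chief_factor A' B' \<Longrightarrow> chief_factor A'' B'' \<Longrightarrow> module_iso A B A'' B''"
  by (rule module_iso_trans) (assumption | erule chief_factor_ideal_top chief_factor_ideal_bot
      psubset_imp_subset[OF chief_factor_subset])+

lemma module_iso_chief_centr:
  "module_iso A B A' B' \<Longrightarrow> chief_factor A B \<Longrightarrow> chief_factor A' B' \<Longrightarrow> centr A B = centr A' B'"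
  by (rule module_iso_centr) (assumption | erule chief_factor_ideal_top chief_factor_ideal_bot
      psubset_imp_subset[OF chief_factor_subset])+

text \<open>Since \<open>L = A + M\<close> and \<open>[C,A] \<subseteq> B \<subseteq> M\<close>, the
  intersection \<open>C \<inter> M\<close> is an ideal, hence inside the core; conversely the core
  centralises \<open>A/B\<close>. Modularity gives \<open>C = A + core M\<close>, and the second
  isomorphism theorem transports \<open>A/B\<close> to \<open>C / core M\<close>.\<close>

lemma maximal_subalg_supplement:
  assumes ch: "chief_factor A B" and M: "maximal_subalg M" and "supplements M A B"
  defines "C \<equiv> centr A B"
  shows core_eq_centr_Int: "core M = C \<inter> M"
    and chief_factor_core: "chief_factor C (core M)"
    and module_iso_core: "module_iso A B C (core M)"
    and lsum_centr_maximal: "lsum C M = UNIV"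
    and monolithic_core: "monolithic_mod (core M)"
proof -
  note iA = chief_factor_ideal_top[OF ch] and iB = chief_factor_ideal_bot[OF ch]
  have iC: "lie_ideal C" unfolding C_def by (rule chief_factor_ideal_centr[OF ch])
  have AC: "A \<subseteq> C" unfolding C_def by (rule chief_factor_subset_centr[OF ch])
  note sM = maximal_subalg_subspace[OF M]
  have sA: "subspace A" and sC: "subspace C" using iA iC by (auto dest: ideal_subspace)
  have sup: "lsum A M = UNIV" "B \<subseteq> M" using assms(3) by (auto simp: supplements_def)
  have iCM: "lie_ideal (C \<inter> M)"
    unfolding lie_ideal_def
  proof (intro conjI allI ballI)
    show "subspace (C \<inter> M)" using sC sM by (rule subspace_inter)
    fix x y assume y: "y \<in> C \<inter> M"
    have "x \<in> lsum A M" using sup by simp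
    then obtain a m where am: "a \<in> A" "m \<in> M" "x = a + m" by (rule lsumE)
    have "br y a \<in> B" using y am by (auto simp: C_def centr_def)
    then have "br a y \<in> B" using br_skew[of a y] iB by (metis ideal_subspace subspace_neg)
    then have "br x y \<in> M"
      using am y sup sM subalg_br[OF maximal_subalg_subalg[OF M]]
      by (auto simp: br_add_left intro: subspace_add)
    then show "br x y \<in> C \<inter> M" using y iC by (auto intro: ideal_br)
  qed
  note core = core_ideal[OF sM] core_subset[OF sM] core_greatest[OF sM]
  have A_nsub: "\<not> A \<subseteq> M"
    using assms(3) supplements_iff_maximal[OF ch M] by blast
  \<comment> \<open>Because \<open>A \<subseteq> C\<close>, this is
    \<open>A \<inter> (C \<inter> M)\<close>, an intersection of two ideals.\<close>
  have iAM: "lie_ideal (A \<inter> M)"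
    using ideal_Int[OF iA iCM] AC by (simp add: inf.absorb1 inf_assoc[symmetric])
  have AM: "A \<inter> M = B"
    using chief_factor_between[OF ch iAM] A_nsub sup chief_factor_subset[OF ch] by blast
  \<comment> \<open>Brackets of the core with \<open>A\<close> fall into
    \<open>A \<inter> M\<close>, which is \<open>B\<close>.\<close>
  have "core M \<subseteq> C"
    unfolding C_def centr_def
  proof safe
    fix x a assume "x \<in> core M" "a \<in> A"
    then have "br x a \<in> A" "br x a \<in> M"
      using iA core by (auto intro: ideal_br ideal_br_left)
    then show "br x a \<in> B" using AM by blast
  qed
  then show cCM: "core M = C \<inter> M"
    using core(2) core(3)[OF iCM] by blast
  have CA: "C = lsum A (core M)"
    using lsum_modular[OF sC AC, of M] sup cCM by simp
  have Ac: "A \<inter> core M = B" using AM AC cCM by blast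
  show chC: "chief_factor C (core M)"
    using chief_factor_diamond[OF iA core(1)] CA Ac ch by simp
  show iso: "module_iso A B C (core M)"
    using module_iso_diamond[OF sA _ core(1)] CA Ac core(1) by (auto dest: ideal_subspace)
  show "lsum C M = UNIV" using sup lsum_mono[OF AC, of M M] by auto
  show "monolithic_mod (core M)"
    unfolding monolithic_mod_def
  proof (intro ex1I[of _ C])
    show minC: "minimal_ideal_mod (core M) C"
      using chC unfolding minimal_ideal_mod_def chief_factor_def by blast
    fix J assume J: "minimal_ideal_mod (core M) J"
    then have iJ: "lie_ideal J" by (simp add: minimal_ideal_mod_def)
    have iJC: "lie_ideal (J \<inter> C)" using iJ iC by (rule ideal_Int)
    show "J = C"
    proof (cases "J \<inter> C = core M")
      case True
      \<comment> \<open>Here \<open>[J,C]\<close> lies in \<open>J \<inter> C = core M\<close>, so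
        \<open>J\<close> centralises \<open>C / core M\<close>. The centraliser of that factor is
        \<open>C\<close> itself, which forces \<open>J\<close> down to the core.\<close>
      have "J \<subseteq> centr C (core M)"
        using True iJ iC by (auto simp: centr_def intro: ideal_br ideal_br_left)
      also have "\<dots> = C"
        using module_iso_chief_centr[OF iso ch chC] by (simp add: C_def)
      finally have "J = core M" using True by blast
      then show ?thesis using J by (auto simp: minimal_ideal_mod_def)
    next
      case False
      then have "core M \<subset> J \<inter> C"
        using J chief_factor_subset[OF chC] by (auto simp: minimal_ideal_mod_def)
      then have "J \<inter> C = J" "J \<inter> C = C"
        using J minC iJC unfolding minimal_ideal_mod_def by blast+
      then show ?thesis by blast
    qed
  qed
qed

text \<open>A subalgebra \<open>S\<close> over \<open>M\<close> meets \<open>C\<close> in an ideal: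
  brackets of \<open>C\<close> with \<open>S \<inter> C\<close> fall into \<open>N\<close> because
  \<open>C/N\<close> is abelian, those of \<open>M\<close> stay in \<open>S\<close>, and
  \<open>L = C + M\<close>. So \<open>S \<inter> C\<close> is \<open>N\<close> or \<open>C\<close>,
  and modularity recovers \<open>S\<close> as \<open>M + (S \<inter> C)\<close>.\<close>

lemma complement_maximal:
  assumes ch: "chief_factor C N" and M: "subalg M" "lsum C M = UNIV" "C \<inter> M = N"
  shows "maximal_subalg M" "supplements M C N"
proof -
  note iC = chief_factor_ideal_top[OF ch]
  have sC: "subspace C" using iC by (rule ideal_subspace)
  show "supplements M C N" using M by (auto simp: supplements_def)
  show "maximal_subalg M"
    unfolding maximal_subalg_def
  proof (intro conjI allI impI M(1))
    show "M \<noteq> UNIV" using M(3) chief_factor_subset[OF ch] by auto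
    fix S assume S: "subalg S \<and> M \<subseteq> S"
    then have sS: "subspace S" by (simp add: subalg_subspace)
    have iSC: "lie_ideal (S \<inter> C)"
      unfolding lie_ideal_def
    proof (intro conjI allI ballI)
      show "subspace (S \<inter> C)" using sS sC by (rule subspace_inter)
      fix x y assume y: "y \<in> S \<inter> C"
      have "x \<in> lsum C M" using M by simp
      then obtain c m where cm: "c \<in> C" "m \<in> M" "x = c + m" by (rule lsumE)
      have "br c y \<in> S" using chief_factor_abelian[OF ch, of c y] cm y M(3) S by blast
      moreover have "br m y \<in> S" using cm y S by (auto intro: subalg_br)
      ultimately have "br x y \<in> S" using cm sS by (simp add: br_add_left subspace_add)
      then show "br x y \<in> S \<inter> C" using y iC by (auto intro: ideal_br)
    qed
    have mod: "S = lsum M (S \<inter> C)"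
      using lsum_modular[OF sS, of M C] S M(2) by (simp add: lsum_commute)
    have "S \<inter> C = N \<or> S \<inter> C = C"
      using S M(3) by (intro chief_factor_between[OF ch iSC]) auto
    then show "S = M \<or> S = UNIV"
    proof
      assume "S \<inter> C = N"
      then have "S \<subseteq> M"
        using mod M(1,3) lsum_least[OF subalg_subspace[OF M(1)], of M "S \<inter> C"] by blast
      then show ?thesis using S by blast
    next
      assume "S \<inter> C = C"
      then show ?thesis using mod M(2) by (simp add: lsum_commute)
    qed
  qed
qed

section \<open>Crowns and the maximal subalgebras of one isomorphism type\<close>

definition crown_maximal :: "'b set \<Rightarrow> 'b set \<Rightarrow> 'b set \<Rightarrow> bool" where
  "crown_maximal A B M \<longleftrightarrow> maximal_subalg M \<and>
     (\<exists>A' B'. chief_factor A' B' \<and> module_iso A' B' A B \<and> supplements M A' B')"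

lemma crown_maximalI:
  "maximal_subalg M \<Longrightarrow> chief_factor A B \<Longrightarrow> supplements M A B \<Longrightarrow> crown_maximal A B M"
  unfolding crown_maximal_def
  by (blast intro: module_iso_refl ideal_subspace chief_factor_ideal_bot)

lemma crown_maximal_cong:
  assumes "module_iso A B A' B'" "chief_factor A B" "chief_factor A' B'"
  shows "crown_maximal A B = crown_maximal A' B'"
  unfolding crown_maximal_def fun_eq_iff
  using assms module_iso_chief_sym module_iso_chief_trans by metis

text \<open>The factor that \<open>M\<close> supplements is isomorphic to \<open>A/B\<close> and so
  has the same centraliser \<open>C\<close>. Hence the facts about it can be restated in terms of
  \<open>A/B\<close> alone.\<close>

lemma crown_maximal_properties:
  assumes ch: "chief_factor A B" and M: "crown_maximal A B M"
  defines "C \<equiv> centr A B"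
  shows crown_maximal_core: "core M = C \<inter> M"
    and crown_maximal_chief: "chief_factor C (core M)"
    and crown_maximal_iso: "module_iso C (core M) A B"
    and crown_maximal_lsum: "lsum C M = UNIV"
    and crown_maximal_monolithic: "monolithic_mod (core M)"
proof -
  obtain A' B' where *: "chief_factor A' B'" "module_iso A' B' A B" "supplements M A' B'"
    and max: "maximal_subalg M"
    using M unfolding crown_maximal_def by blast
  have C: "C = centr A' B'" unfolding C_def using * ch by (metis module_iso_chief_centr)
  note p = maximal_subalg_supplement[OF *(1) max *(3), folded C]
  show "core M = C \<inter> M" "chief_factor C (core M)" "lsum C M = UNIV" "monolithic_mod (core M)"
    using p by blast+
  have "module_iso C (core M) A' B'" using p * by (blast intro: module_iso_chief_sym)
  then show "module_iso C (core M) A B" using p * ch by (blast intro: module_iso_chief_trans)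
qed

text \<open>A minimal ideal over \<open>N\<close> gives a chief factor, which is abelian, whereas
  type 3 demands non-abelian ones. Thus connected factors are just isomorphic ones.\<close>

lemma not_primitive_type3_mod: "\<not> primitive_type3_mod N I J"
proof
  assume t: "primitive_type3_mod N I J"
  then have "minimal_ideal_mod N I" "lie_ideal N" "nonabelian_mod N I"
    unfolding primitive_type3_mod_def by blast+
  then have "chief_factor I N"
    unfolding chief_factor_def minimal_ideal_mod_def by blast
  then show False
    using chief_factor_abelian \<open>nonabelian_mod N I\<close> unfolding nonabelian_mod_def by blast
qed

text \<open>The conditions in the definition of \<open>R\<close> collapse to
  \<open>crown_maximal\<close>: connected means isomorphic, every maximal subalgebra makes the
  quotient by its core primitive, and a maximal supplement makes that quotient monolithic.\<close>

lemma crown_bot_eq: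
  assumes "chief_factor A B"
  shows "crown_bot A B = \<Inter>{core M | M. crown_maximal A B M}"
proof -
  have "(maximal_subalg M \<and> monolithic_mod (core M) \<and> primitive_mod (core M) \<and>
      (\<exists>A' B'. chief_factor A' B' \<and> connected A' B' A B \<and> supplements M A' B'))
    \<longleftrightarrow> crown_maximal A B M" for M
  proof -
    have "connected A' B' A B \<longleftrightarrow> module_iso A' B' A B" for A' B'
      using not_primitive_type3_mod by (auto simp: connected_def)
    moreover have "primitive_mod (core M)" if "maximal_subalg M"
      unfolding primitive_mod_def using that core_subset maximal_subalg_subspace by blast
    ultimately show ?thesis
      using crown_maximal_monolithic[OF assms] unfolding crown_maximal_def by blast
  qed
  then show ?thesis unfolding crown_bot_def by simp
qed

lemma crown_cong:
  assumes "module_iso A B A' B'" "chief_factor A B" "chief_factor A' B'"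
  shows "crown_top A B = crown_top A' B'" "crown_bot A B = crown_bot A' B'"
  using assms module_iso_chief_centr[OF assms] crown_maximal_cong[OF assms]
  by (simp_all add: crown_top_eq crown_bot_eq)

lemma crown_bot_subset_core:
  "chief_factor A B \<Longrightarrow> crown_maximal A B M \<Longrightarrow> crown_bot A B \<subseteq> core M"
  by (auto simp: crown_bot_eq)

lemma crown_bot_cases:
  assumes "chief_factor A B"
  shows "crown_bot A B = UNIV \<or> crown_bot A B \<subseteq> crown_top A B"
proof (cases "\<exists>M. crown_maximal A B M")
  case True
  then show ?thesis
    using crown_bot_subset_core[OF assms] crown_maximal_core[OF assms] crown_top_eq[OF assms]
    by blast
next
  case False
  then show ?thesis by (simp add: crown_bot_eq[OF assms])
qed

lemma subspace_crown_bot: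
  assumes "chief_factor A B"
  shows "subspace (crown_bot A B)"
  unfolding crown_bot_eq[OF assms]
  by (intro subspace_Inter)
    (auto simp: crown_maximal_def intro: ideal_subspace core_ideal maximal_subalg_subspace)

text \<open>The new member has core N'' = I + (N \<inter> N'), where N, N' are the cores of M, M'.  It is again
  of the right type because both C/N'' and C/N are isomorphic to N'/(N \<inter> N').\<close>
lemma crown_maximal_exchange:
  assumes ch: "chief_factor A B" and M: "crown_maximal A B M" and M': "crown_maximal A B M'"
    and neq: "core M \<noteq> core M'"
    and I: "lie_ideal I" "I \<subseteq> centr A B" "\<not> I \<subseteq> M'" "I \<inter> core M' \<subseteq> core M"
  shows "crown_maximal A B (lsum I (M \<inter> M'))"
    and "lsum I (M \<inter> M') \<inter> core M' \<subseteq> M"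
proof -
  define C where "C = centr A B"
  note p = crown_maximal_properties[OF ch M, folded C_def]
  note p' = crown_maximal_properties[OF ch M', folded C_def]
  have max: "maximal_subalg M" "maximal_subalg M'"
    using M M' by (auto simp: crown_maximal_def)
  have iC: "lie_ideal C" unfolding C_def by (rule chief_factor_ideal_centr[OF ch])
  have iN: "lie_ideal (core M)" "lie_ideal (core M')"
    using chief_factor_ideal_bot[OF p(2)] chief_factor_ideal_bot[OF p'(2)] by blast+
  have sub: "subspace C" "subspace I" "subspace (core M)" "subspace (core M')"
    using iC I(1) iN by (auto dest: ideal_subspace)
  have NC: "core M \<subset> C" "core M' \<subset> C"
    using chief_factor_subset[OF p(2)] chief_factor_subset[OF p'(2)] by blast+
  define N where "N = lsum I (core M \<inter> core M')"
  have iN'': "lie_ideal N" unfolding N_def by (intro ideal_lsum ideal_Int I(1) iN)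
  have sN: "subspace N" by (rule ideal_subspace[OF iN''])
  \<comment> \<open>Each core is maximal among the ideals properly inside \<open>C\<close>, so
    distinct cores are incomparable.\<close>
  have n1: "\<not> core M \<subseteq> core M'"
    using chief_factor_between[OF p(2) iN(2)] NC neq by blast
  have n2: "\<not> core M' \<subseteq> core M"
    using chief_factor_between[OF p'(2) iN(1)] NC neq by blast
  have IC: "I \<subseteq> C" using I(2) by (simp add: C_def)
  have Int: "C \<inter> lsum I (M \<inter> M') = N"
    using lsum_modular[OF sub(1) IC, of "M \<inter> M'"] p(1) p'(1)
    by (simp add: N_def Int_ac)
  \<comment> \<open>Modularity gives
    \<open>(core M \<inter> core M') + (core M' \<inter> I)\<close>, and the second summand lies in
    \<open>core M\<close> by assumption.\<close>
  have NN: "N \<inter> core M' = core M \<inter> core M'"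
  proof -
    have "core M' \<inter> lsum (core M \<inter> core M') I = lsum (core M \<inter> core M') (core M' \<inter> I)"
      using sub by (intro lsum_modular) auto
    moreover have "lsum (core M \<inter> core M') (core M' \<inter> I) \<subseteq> core M \<inter> core M'"
      using I(4) sub by (intro lsum_least subspace_inter) auto
    moreover have "core M \<inter> core M' \<subseteq> N" unfolding N_def using sub(2) by (rule lsum_right)
    ultimately show ?thesis unfolding N_def by (auto simp: lsum_commute)
  qed
  have C1: "C = lsum (core M') (core M)"
    using chief_factor_lsum[OF p(2) iN(2) _ n2] NC by auto
  \<comment> \<open>As \<open>I\<close> is not inside \<open>M'\<close>, it is not inside
    \<open>core M'\<close>; so \<open>I + core M'\<close> is all of \<open>C\<close>.\<close>
  have C2: "C = lsum (core M') N"
  proof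
    have "C = lsum I (core M')"
      using chief_factor_lsum[OF p'(2) I(1) IC] I(3) core_subset[OF maximal_subalg_subspace[OF max(2)]]
      by blast
    also have "\<dots> \<subseteq> lsum (core M') N"
      unfolding N_def using sub
      by (subst lsum_commute) (intro lsum_mono order_refl lsum_left subspace_inter)
    finally show "C \<subseteq> lsum (core M') N" .
    show "lsum (core M') N \<subseteq> C"
      using NC IC sub unfolding N_def by (intro lsum_least) auto
  qed
  have ch1: "chief_factor (core M') (core M' \<inter> core M)"
    using chief_factor_diamond[OF iN(2,1)] C1 p(2) by simp
  then have ch1': "chief_factor (core M') (core M' \<inter> N)"
    using NN by (simp add: Int_commute)
  have chN: "chief_factor C N"
    using chief_factor_diamond[OF iN(2) iN''] C2 ch1' by simp
  have "module_iso (core M') (core M' \<inter> core M) C (core M)"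
    using module_iso_diamond[OF sub(4,3) iN(1)] C1 by simp
  moreover have "module_iso (core M') (core M' \<inter> core M) C N"
    using module_iso_diamond[OF sub(4) sN iN''] C2 NN by (simp add: Int_commute)
  ultimately have iso: "module_iso C N A B"
    using p(2,3) ch1 chN ch by (meson module_iso_chief_sym module_iso_chief_trans)
  \<comment> \<open>Write \<open>m\<close> in \<open>M\<close> as \<open>k + m'\<close> with
    \<open>k\<close> in \<open>core M\<close> and \<open>m'\<close> in \<open>M'\<close>. Then
    \<open>m' = m - k\<close> stays in \<open>M\<close>, and \<open>k\<close> is absorbed by
    \<open>C\<close>.\<close>
  have "lsum C (lsum I (M \<inter> M')) = UNIV"
  proof -
    have "z \<in> lsum C (M \<inter> M')" for z
    proof -
      have "z \<in> lsum C M" using p by simp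
      then obtain c m where cm: "c \<in> C" "m \<in> M" "z = c + m" by (rule lsumE)
      have "\<not> core M \<subseteq> M'" using n1 p'(1) NC by blast
      then have "m \<in> lsum (core M) M'" using maximal_subalg_lsum_ideal[OF max(2) iN(1)] by simp
      then obtain k m' where k: "k \<in> core M" "m' \<in> M'" "m = k + m'" by (rule lsumE)
      have "m - k \<in> M"
        using cm k maximal_subalg_subspace[OF max(1)] core_subset
        by (blast intro: subspace_diff)
      then have "m' \<in> M \<inter> M'" using k by simp
      moreover have "c + k \<in> C" using cm k NC sub(1) by (blast intro: subspace_add)
      ultimately have "(c + k) + m' \<in> lsum C (M \<inter> M')" by (rule lsumI[rotated])
      then show ?thesis using cm k by (simp add: add.assoc)
    qed
    then show ?thesis using lsum_mono[OF order_refl lsum_right[OF sub(2)], of C "M \<inter> M'"] by blast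
  qed
  then have "maximal_subalg (lsum I (M \<inter> M'))" "supplements (lsum I (M \<inter> M')) C N"
    using complement_maximal[OF chN _ _ Int] I(1) max
    by (simp_all add: subalg_lsum subalg_Int maximal_subalg_subalg)
  then show "crown_maximal A B (lsum I (M \<inter> M'))"
    using chN iso unfolding crown_maximal_def by blast
  \<comment> \<open>Elements of the intersection lie in \<open>N \<inter> core M'\<close>, hence in
    \<open>core M\<close>. So a subset of \<open>core M'\<close> that is not inside \<open>M\<close>
    is not inside the new subalgebra either.\<close>
  show "lsum I (M \<inter> M') \<inter> core M' \<subseteq> M"
    using Int NN NC p(1) by blast
qed

section \<open>Complements of a crown from a chief series\<close>

lemma crown_complement:
  fixes A B :: "'b set" and Ls :: "nat \<Rightarrow> 'b set"
  defines "C \<equiv> crown_top A B" and "R \<equiv> crown_bot A B"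
  assumes ser: "chief_series Ls n" and ch: "chief_factor A B"
    and J: "J = {i \<in> {1..n}. \<not> frattini_factor (Ls i) (Ls (i - 1)) \<and>
      (crown_top (Ls i) (Ls (i - 1)), crown_bot (Ls i) (Ls (i - 1))) = (C, R)}"
    and Ms: "\<And>i. i \<in> J \<Longrightarrow> maximal_subalg (Ms i) \<and> Ls (i - 1) \<subseteq> Ms i \<and> \<not> Ls i \<subseteq> Ms i"
  shows "complement_mod (\<Inter>i\<in>J. Ms i) C R"
proof -
  \<comment> \<open>The set \<open>J\<close> is selected by equality of the crowns, without
    presupposing that its factors are isomorphic to \<open>A/B\<close>. What is used is that they
    share \<open>C\<close> and \<open>R\<close>, and that every non-Frattini factor of the series
    isomorphic to \<open>A/B\<close> has its index in \<open>J\<close>.\<close>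
  have chL: "chief_factor (Ls i) (Ls (i - 1))" if "i \<in> {1..n}" for i
    using ser that by (simp add: chief_series_def)
  have Jn: "i \<in> {1..n}" if "i \<in> J" for i using that J by simp
  have C: "C = centr A B" unfolding C_def by (rule crown_top_eq[OF ch])
  have iC: "lie_ideal C" unfolding C by (rule chief_factor_ideal_centr[OF ch])
  have sC: "subspace C" using iC by (rule ideal_subspace)
  have CJ: "centr (Ls i) (Ls (i - 1)) = C" if "i \<in> J" for i
    using that crown_top_eq[OF chL] J by auto
  have RJ: "crown_bot (Ls i) (Ls (i - 1)) = R" if "i \<in> J" for i
    using that J by auto
  have LC: "Ls i \<subseteq> C" if "i \<in> J" for i
    using that CJ chief_factor_subset_centr[OF chL[OF Jn]] by blast
  have cm: "crown_maximal (Ls i) (Ls (i - 1)) (Ms i)" if "i \<in> J" for i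
    using that Ms chL[OF Jn] by (intro crown_maximalI) (auto simp: supplements_iff_maximal)
  define K where "K = (\<Inter>i\<in>J. Ms i)"
  have subK: "subalg K"
  proof -
    have "subalg (Ms i)" if "i \<in> J" for i using Ms[OF that] by (simp add: maximal_subalg_subalg)
    then show ?thesis unfolding K_def by (auto simp: subalg_def intro!: subspace_Inter)
  qed
  have RK: "R \<subseteq> K"
    unfolding K_def
  proof
    fix x assume x: "x \<in> R"
    show "x \<in> (\<Inter>i\<in>J. Ms i)"
    proof
      fix i assume i: "i \<in> J"
      have "R \<subseteq> core (Ms i)"
        using crown_bot_subset_core[OF chL[OF Jn[OF i]] cm[OF i]] RJ[OF i] by simp
      then show "x \<in> Ms i" using x Ms[OF i] core_subset maximal_subalg_subspace by blast
    qed
  qed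
  \<comment> \<open>The members are brought in from the top of the series downwards. The
    intersection \<open>T\<close> of the later ones contains \<open>Ls (Suc k)\<close>, so by
    modularity \<open>T\<close> is the sum of \<open>Ls (Suc k)\<close>, which lies in
    \<open>C\<close>, and \<open>T \<inter> Ms (Suc k)\<close>.\<close>
  have KC: "lsum C (\<Inter>i\<in>{i\<in>J. k < i}. Ms i) = UNIV" if "k \<le> n" for k
    using that
  proof (induction k rule: inc_induct)
    case base
    have T: "{i \<in> J. n < i} = {}" by (auto dest: Jn)
    have "lsum C UNIV = UNIV" using lsum_right[OF sC, of UNIV] by auto
    then show ?case unfolding T by simp
  next
    case (step k)
    show ?case
    proof (cases "Suc k \<in> J")
      case False
      then have "{i \<in> J. Suc k < i} = {i \<in> J. k < i}"
        by (auto simp: less_Suc_eq_le Suc_le_eq) (metis Suc_lessI)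
      then show ?thesis using step by simp
    next
      case True
      define T where "T = (\<Inter>i\<in>{i\<in>J. Suc k < i}. Ms i)"
      have "{i \<in> J. k < i} = insert (Suc k) {i \<in> J. Suc k < i}"
        using True by (auto intro: Suc_lessI)
      then have T: "(\<Inter>i\<in>{i\<in>J. k < i}. Ms i) = T \<inter> Ms (Suc k)"
        unfolding T_def by auto
      have sT: "subspace T"
        unfolding T_def using Ms[THEN conjunct1, THEN maximal_subalg_subspace]
        by (intro subspace_Inter) auto
      \<comment> \<open>A later index \<open>i\<close> satisfies \<open>Suc k \<le> i - 1\<close>,
        and \<open>Ms i\<close> contains \<open>Ls (i - 1)\<close>.\<close>
      have LT: "Ls (Suc k) \<subseteq> T"
        unfolding T_def
      proof (rule INT_greatest)
        fix i assume i: "i \<in> {i \<in> J. Suc k < i}"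
        then have "Ls (Suc k) \<subseteq> Ls (i - 1)"
          using Jn[of i] by (intro chief_series_mono[OF ser]) auto
        then show "Ls (Suc k) \<subseteq> Ms i" using Ms i by blast
      qed
      have "lsum (Ls (Suc k)) (Ms (Suc k)) = UNIV"
        using Ms[OF True] chL[OF Jn[OF True]]
        by (intro maximal_subalg_lsum_ideal) (auto dest: chief_factor_ideal_top)
      then have "T = lsum (Ls (Suc k)) (T \<inter> Ms (Suc k))"
        using lsum_modular[OF sT LT, of "Ms (Suc k)"] by simp
      also have "\<dots> \<subseteq> lsum C (T \<inter> Ms (Suc k))"
        using LC[OF True] by (intro lsum_mono) auto
      finally have "lsum C T \<subseteq> lsum C (T \<inter> Ms (Suc k))"
        using Ms[OF True] sT sC
        by (intro lsum_least subspace_lsum subspace_inter lsum_left) (auto intro: maximal_subalg_subspace)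
      then show ?thesis using step.IH T unfolding T_def by auto
    qed
  qed
  have "{i \<in> J. 0 < i} = J" by (auto dest: Jn)
  with KC[of 0] have KC: "lsum K C = UNIV" by (simp add: K_def lsum_commute)
  have D: "C \<inter> K \<subseteq> M" if M: "crown_maximal A B M" for M
  proof (rule ccontr)
    assume nM: "\<not> C \<inter> K \<subseteq> M"
    \<comment> \<open>A counterexample is pushed up the series until it contains
      \<open>Ls n\<close>, the whole algebra, which no maximal subalgebra does.\<close>
    have "\<exists>M. crown_maximal A B M \<and> \<not> C \<inter> K \<subseteq> M \<and> Ls k \<subseteq> M" if "k \<le> n" for k
      using that
    proof (induction k)
      case 0
      have "0 \<in> M" using M by (auto simp: crown_maximal_def intro: subspace_0 maximal_subalg_subspace)
      then show ?case using M nM ser by (auto simp: chief_series_def)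
    next
      case (Suc k)
      then obtain M where M: "crown_maximal A B M" "\<not> C \<inter> K \<subseteq> M" "Ls k \<subseteq> M" by auto
      show ?case
      proof (cases "Ls (Suc k) \<subseteq> M")
        case True
        then show ?thesis using M by blast
      next
        case False
        have k: "Suc k \<in> {1..n}" using Suc by simp
        have chk: "chief_factor (Ls (Suc k)) (Ls k)" using chL[OF k] by simp
        have max: "maximal_subalg M" using M by (simp add: crown_maximal_def)
        have sup: "supplements M (Ls (Suc k)) (Ls k)"
          using M False by (simp add: supplements_iff_maximal[OF chk max])
        note q = maximal_subalg_supplement[OF chk max sup]
        note p = crown_maximal_properties[OF ch M(1), folded C]
        \<comment> \<open>Both centralisers are minimal ideals over \<open>core M\<close>, and there
          is only one. So the factor at which \<open>M\<close> fails has the type of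
          \<open>A/B\<close>.\<close>
        have "centr (Ls (Suc k)) (Ls k) = C"
          using monolithic_mod_unique[OF q(5,2) p(2)] .
        note q = q[unfolded this]
        have iso: "module_iso (Ls (Suc k)) (Ls k) A B"
          using q p chk ch by (blast intro: module_iso_chief_trans)
        have nf: "\<not> frattini_factor (Ls (Suc k)) (Ls k)"
          using not_frattini_factor_iff[OF chk] M max False by blast
        have kJ: "Suc k \<in> J"
          unfolding J C_def R_def using k nf crown_cong[OF iso chk ch] by simp
        have M': "crown_maximal A B (Ms (Suc k))"
          using cm[OF kJ] crown_maximal_cong[OF iso chk ch] by simp
        note p' = crown_maximal_properties[OF ch M', folded C]
        have KM': "C \<inter> K \<subseteq> core (Ms (Suc k))"
          using p'(1) kJ unfolding K_def by blast
        have neq: "core M \<noteq> core (Ms (Suc k))" using KM' M p(1) by blast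
        \<comment> \<open>Inside \<open>C\<close>, the subalgebra \<open>Ms (Suc k)\<close> agrees
          with its core. The intersection is therefore an ideal between \<open>Ls k\<close> and
          \<open>Ls (Suc k)\<close>, and it is not the latter. This yields the last hypothesis of
          the exchange.\<close>
        have "Ls (Suc k) \<inter> Ms (Suc k) \<subseteq> Ls k"
        proof -
          have *: "lie_ideal (Ls (Suc k) \<inter> core (Ms (Suc k)))"
            using chief_factor_ideal_top[OF chk] chief_factor_ideal_bot[OF p'(2)] by (rule ideal_Int)
          have eq: "Ls (Suc k) \<inter> core (Ms (Suc k)) = Ls (Suc k) \<inter> Ms (Suc k)"
            using p'(1) LC[OF kJ] by blast
          show ?thesis
            using chief_factor_between[OF chk *] eq Ms[OF kJ] chief_factor_subset[OF chk] by auto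
        qed
        then have "Ls (Suc k) \<inter> core (Ms (Suc k)) \<subseteq> core M"
          using p(1) p'(1) M(3) LC[OF kJ] chief_factor_subset[OF chk] by blast
        note ex = crown_maximal_exchange[OF ch M(1) M' neq chief_factor_ideal_top[OF chk]
            LC[OF kJ, unfolded C] conjunct2[OF conjunct2[OF Ms[OF kJ]]] this]
        have "Ls (Suc k) \<subseteq> lsum (Ls (Suc k)) (M \<inter> Ms (Suc k))"
          using max Ms[OF kJ] by (intro lsum_left subspace_inter maximal_subalg_subspace) auto
        moreover have "\<not> C \<inter> K \<subseteq> lsum (Ls (Suc k)) (M \<inter> Ms (Suc k))"
          using ex(2) KM' M(2) by blast
        ultimately show ?thesis using ex(1) by blast
      qed
    qed
    from this[of n] ser obtain M where "crown_maximal A B M" "M = UNIV"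
      unfolding chief_series_def by auto
    then show False by (auto simp: crown_maximal_def dest: maximal_subalg_neq_UNIV)
  qed
  have DR: "C \<inter> K \<subseteq> R"
    unfolding R_def crown_bot_eq[OF ch]
    using D crown_maximal_core[OF ch] C by blast
  \<comment> \<open>The complement condition speaks of cosets; when \<open>R \<subseteq> C\<close>,
    an element \<open>x\<close> congruent to some \<open>c\<close> in \<open>C\<close> lies in
    \<open>C\<close> itself.\<close>
  have "x \<in> R" if "x \<in> K" "c \<in> C" "x - c \<in> R" for x c
  proof (cases "R = UNIV")
    case False
    then have "R \<subseteq> C" using crown_bot_cases[OF ch] by (simp add: C_def R_def)
    then have "(x - c) + c \<in> C" using that sC by (blast intro: subspace_add)
    then show ?thesis using that DR by auto
  qed simp
  then show ?thesis
    using subK RK KC unfolding complement_mod_def K_def by blast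
qed

section \<open>Existence of a chief series\<close>

lemma ideal_zero: "lie_ideal {0}"
  by (simp add: lie_ideal_def)

lemma ideal_UNIV: "lie_ideal UNIV"
  by (simp add: lie_ideal_def)

lemma chief_series_exists: "\<exists>Ls n. chief_series Ls n"
proof -
  obtain S where S: "finite S" "span S = UNIV" using finite_dim by (auto simp: fin_dim_def)
  obtain E where E: "E \<subseteq> S" "independent E" "S \<subseteq> span E"
    using maximal_independent_subset by blast
  have "span E = UNIV" using E S span_minimal[of S "span E"] by auto
  then interpret fd: finite_dimensional_vector_space scale E
    using E S finite_subset by unfold_locales auto
  have lt: "dim I < dim J" if "lie_ideal I" "lie_ideal J" "I \<subset> J" for I J
  proof -
    have "span I = I" "span J = J" using that by (simp_all only: span_eq_iff ideal_subspace)
    then show ?thesis using that(3) fd.dim_psubset[of I J] by (simp only: simp_thms)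
  qed
  \<comment> \<open>The chain is built upwards from an arbitrary ideal \<open>B\<close>, by
    induction on its codimension.\<close>
  have "\<exists>(Ls :: nat \<Rightarrow> 'b set) n. Ls 0 = B \<and> Ls n = UNIV \<and> (\<forall>i\<in>{1..n}. chief_factor (Ls i) (Ls (i - 1)))"
    if "lie_ideal B" for B
    using that
  proof (induction "fd.dimension - dim B" arbitrary: B rule: less_induct)
    case less
    show ?case
    proof (cases "B = UNIV")
      case True
      then show ?thesis by (intro exI[of _ "\<lambda>_. UNIV"] exI[of _ 0]) auto
    next
      case False
      then have "lie_ideal UNIV \<and> B \<subset> UNIV" using ideal_UNIV by blast
      \<comment> \<open>An ideal of least dimension among those properly above \<open>B\<close>
        leaves no ideal strictly between, as proper inclusion lowers the dimension.\<close>
      then obtain A where A: "lie_ideal A \<and> B \<subset> A"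
        and min: "\<And>I. lie_ideal I \<and> B \<subset> I \<Longrightarrow> dim A \<le> dim I"
        using ex_has_least_nat[of "\<lambda>I. lie_ideal I \<and> B \<subset> I" UNIV dim] by blast
      have chA: "chief_factor A B"
        unfolding chief_factor_def
      proof (intro conjI allI impI)
        fix I assume I: "lie_ideal I \<and> B \<subseteq> I \<and> I \<subseteq> A"
        show "I = B \<or> I = A"
        proof (rule ccontr)
          assume "\<not> ?thesis"
          then have "B \<subset> I" "I \<subset> A" using I by auto
          then show False using lt[of I A] min[of I] I A by auto
        qed
      qed (use A less.prems in auto)
      have "dim A \<le> fd.dimension" by (rule fd.dim_subset_UNIV)
      then have "fd.dimension - dim A < fd.dimension - dim B"
        using lt[of B A] A less.prems by auto
      from less.hyps[OF this] A obtain Ls :: "nat \<Rightarrow> 'b set" and n where Ls: "Ls 0 = A"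
        "Ls n = UNIV" "\<forall>i\<in>{1..n}. chief_factor (Ls i) (Ls (i - 1))" by blast
      \<comment> \<open>\<open>case_nat B Ls\<close> puts \<open>B\<close> in front and shifts the
        old chain by one: index 1 gives \<open>A\<close> over \<open>B\<close>, later indices give
        the old factors.\<close>
      have "chief_factor (case_nat B Ls i) (case_nat B Ls (i - 1))" if "i \<in> {1..Suc n}" for i
      proof -
        obtain j where j: "i = Suc j" "j \<le> n" using \<open>i \<in> {1..Suc n}\<close> by (cases i) auto
        show ?thesis using j Ls(1) chA bspec[OF Ls(3), of j] by (cases j) auto
      qed
      then show ?thesis
        using Ls by (intro exI[of _ "case_nat B Ls"] exI[of _ "Suc n"]) auto
    qed
  qed
  then show ?thesis using ideal_zero unfolding chief_series_def by blast
qed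

section \<open>Prefrattini subalgebras as intersections of crown complements\<close>

lemma chief_factor_crown:
  assumes "chief_factor A B" "\<not> frattini_factor A B"
  shows "(crown_top A B, crown_bot A B) \<in> crowns"
  using assms not_frattini_factor_iff supplements_iff_maximal
  unfolding crowns_def supplemented_def by blast

text \<open>The choice \<open>K\<close> is a function of the pair \<open>(C, R)\<close>, so chief
  factors with equal crowns share one complement. Both directions regroup the indices of a chief
  series by crown.\<close>

theorem prefrattini_iff_crown_complements:
  "prefrattini U \<longleftrightarrow>
    (\<exists>K. (\<forall>CR\<in>crowns. complement_mod (K CR) (fst CR) (snd CR)) \<and> U = (\<Inter>CR\<in>crowns. K CR))"
proof
  assume "prefrattini U"
  then obtain Ls n Ms where ser: "chief_series Ls n"
    and Ms: "\<forall>i\<in>{i\<in>{1..n}. \<not> frattini_factor (Ls i) (Ls (i - 1))}.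
      maximal_subalg (Ms i) \<and> Ls (i - 1) \<subseteq> Ms i \<and> \<not> Ls i \<subseteq> Ms i"
    and U: "U = (\<Inter>i\<in>{i\<in>{1..n}. \<not> frattini_factor (Ls i) (Ls (i - 1))}. Ms i)"
    unfolding prefrattini_def by blast
  define cr where "cr i = (crown_top (Ls i) (Ls (i - 1)), crown_bot (Ls i) (Ls (i - 1)))" for i
  define J where "J CR = {i \<in> {1..n}. \<not> frattini_factor (Ls i) (Ls (i - 1)) \<and> cr i = CR}" for CR
  have "complement_mod (\<Inter>i\<in>J CR. Ms i) (fst CR) (snd CR)" if CR: "CR \<in> crowns" for CR
  proof -
    obtain A B where AB: "chief_factor A B" "CR = (crown_top A B, crown_bot A B)"
      using CR by (auto simp: crowns_def)
    have "complement_mod (\<Inter>i\<in>J CR. Ms i) (crown_top A B) (crown_bot A B)"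
      using Ms by (intro crown_complement[OF ser AB(1)]) (auto simp: J_def AB(2) cr_def)
    then show ?thesis by (simp add: AB)
  qed
  moreover have "U = (\<Inter>CR\<in>crowns. \<Inter>i\<in>J CR. Ms i)"
  proof -
    \<comment> \<open>No index is lost in the grouping, and a crown without indices contributes the
      whole algebra.\<close>
    have "cr i \<in> crowns" if "i \<in> {1..n}" "\<not> frattini_factor (Ls i) (Ls (i - 1))" for i
      unfolding cr_def using that ser by (intro chief_factor_crown) (auto simp: chief_series_def)
    then show ?thesis unfolding U J_def by blast
  qed
  ultimately show "\<exists>K. (\<forall>CR\<in>crowns. complement_mod (K CR) (fst CR) (snd CR)) \<and>
      U = (\<Inter>CR\<in>crowns. K CR)"
    by (intro exI[of _ "\<lambda>CR. \<Inter>i\<in>J CR. Ms i"]) blast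
next
  assume "\<exists>K. (\<forall>CR\<in>crowns. complement_mod (K CR) (fst CR) (snd CR)) \<and>
      U = (\<Inter>CR\<in>crowns. K CR)"
  then obtain K where K: "\<And>CR. CR \<in> crowns \<Longrightarrow> complement_mod (K CR) (fst CR) (snd CR)"
    and U: "U = (\<Inter>CR\<in>crowns. K CR)" by blast
  \<comment> \<open>Since \<open>prefrattini\<close> quantifies existentially over the series, any
    one may be fixed.\<close>
  obtain Ls n where ser: "chief_series Ls n" using chief_series_exists by blast
  define I where "I = {i\<in>{1..n}. \<not> frattini_factor (Ls i) (Ls (i - 1))}"
  define cr where "cr i = (crown_top (Ls i) (Ls (i - 1)), crown_bot (Ls i) (Ls (i - 1)))" for i
  have chL: "chief_factor (Ls i) (Ls (i - 1))" if "i \<in> I" for i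
    using that ser by (simp add: chief_series_def I_def)
  have crI: "cr i \<in> crowns" if "i \<in> I" for i
    unfolding cr_def using that chL by (intro chief_factor_crown) (auto simp: I_def)
  have "\<exists>M. maximal_subalg M \<and> Ls (i - 1) \<subseteq> M \<and> \<not> Ls i \<subseteq> M" if "i \<in> I" for i
    using that not_frattini_factor_iff[OF chL] by (auto simp: I_def)
  then obtain Ws where Ws: "\<And>i. i \<in> I \<Longrightarrow>
      maximal_subalg (Ws i) \<and> Ls (i - 1) \<subseteq> Ws i \<and> \<not> Ls i \<subseteq> Ws i" by metis
  \<comment> \<open>Only the core of the auxiliary \<open>Ws i\<close> is kept; adding the given
    complement to it produces a maximal subalgebra containing that complement.\<close>
  define Ms where "Ms i = lsum (core (Ws i)) (K (cr i))" for i
  have KM: "K (cr i) \<subseteq> Ms i" if "i \<in> I" for i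
    unfolding Ms_def using Ws[OF that]
    by (intro lsum_right ideal_subspace core_ideal maximal_subalg_subspace) auto
  have Ms: "maximal_subalg (Ms i) \<and> Ls (i - 1) \<subseteq> Ms i \<and> \<not> Ls i \<subseteq> Ms i" if i: "i \<in> I" for i
  proof -
    define A B where "A = Ls i" and "B = Ls (i - 1)"
    define C R where "C = centr A B" and "R = crown_bot A B"
    have ch: "chief_factor A B" using chL[OF i] by (simp add: A_def B_def)
    have W: "maximal_subalg (Ws i)" "B \<subseteq> Ws i" "\<not> A \<subseteq> Ws i"
      using Ws[OF i] by (auto simp: A_def B_def)
    have cm: "crown_maximal A B (Ws i)"
      using W ch by (intro crown_maximalI) (simp_all add: supplements_iff_maximal)
    note p = crown_maximal_properties[OF ch cm, folded C_def]
    have sW: "subspace (Ws i)" using W(1) by (rule maximal_subalg_subspace)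
    have iN: "lie_ideal (core (Ws i))" using sW by (rule core_ideal)
    have sN: "subspace (core (Ws i))" using iN by (rule ideal_subspace)
    have sC: "subspace C" using chief_factor_ideal_top[OF p(2)] by (rule ideal_subspace)
    have cmp: "complement_mod (K (cr i)) C R"
      using K[OF crI[OF i]] crown_top_eq[OF ch]
      by (simp add: cr_def A_def B_def C_def R_def)
    then have kK: "subalg (K (cr i))" "lsum C (K (cr i)) = UNIV"
      by (simp_all add: complement_mod_def lsum_commute)
    have "0 \<in> R" unfolding R_def using subspace_crown_bot[OF ch] by (rule subspace_0)
    \<comment> \<open>For \<open>x\<close> in both, take \<open>c = x\<close> in the complement
      condition.\<close>
    then have "C \<inter> K (cr i) \<subseteq> R"
      using cmp unfolding complement_mod_def by (metis IntE diff_self subsetI)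
    then have CK: "C \<inter> K (cr i) \<subseteq> core (Ws i)"
      using crown_bot_subset_core[OF ch cm] by (simp add: R_def)
    have NM: "core (Ws i) \<subseteq> Ms i"
      unfolding Ms_def using kK by (intro lsum_left subalg_subspace)
    \<comment> \<open>By modularity the new subalgebra meets \<open>C\<close> exactly in
      \<open>core (Ws i)\<close>, as \<open>complement_maximal\<close> demands.\<close>
    have "C \<inter> Ms i = lsum (core (Ws i)) (C \<inter> K (cr i))"
      unfolding Ms_def using chief_factor_subset[OF p(2)] by (intro lsum_modular sC) auto
    also have "\<dots> \<subseteq> core (Ws i)" using CK sN by (intro lsum_least) auto
    finally have CM: "C \<inter> Ms i = core (Ws i)"
      using NM chief_factor_subset[OF p(2)] by blast
    have "maximal_subalg (Ms i)"
    proof (rule complement_maximal(1)[OF p(2)])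
      show "subalg (Ms i)" unfolding Ms_def using iN kK(1) by (rule subalg_lsum)
      show "lsum C (Ms i) = UNIV"
        using kK(2) lsum_mono[OF order_refl KM[OF i], of C] by auto
    qed (rule CM)
    moreover have "B \<subseteq> Ms i"
      using core_greatest[OF sW chief_factor_ideal_bot[OF ch] W(2)] NM by blast
    moreover have "\<not> A \<subseteq> Ms i"
      using CM chief_factor_subset_centr[OF ch] core_subset[OF sW] W(3) unfolding C_def by blast
    ultimately show ?thesis by (simp add: A_def B_def)
  qed
  \<comment> \<open>Both sides are complements of the same crown and the left one lies in the right
    one, so they coincide.\<close>
  have "K CR = (\<Inter>i\<in>{i\<in>I. cr i = CR}. Ms i)" if CR: "CR \<in> crowns" for CR
  proof -
    obtain A B where AB: "chief_factor A B" "CR = (crown_top A B, crown_bot A B)"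
      using CR by (auto simp: crowns_def)
    have "complement_mod (\<Inter>i\<in>{i\<in>I. cr i = CR}. Ms i) (crown_top A B) (crown_bot A B)"
      using Ms by (intro crown_complement[OF ser AB(1)]) (auto simp: I_def AB(2) cr_def)
    moreover have "complement_mod (K CR) (crown_top A B) (crown_bot A B)"
      using K[OF CR] by (simp add: AB)
    moreover have "K CR \<subseteq> (\<Inter>i\<in>{i\<in>I. cr i = CR}. Ms i)" using KM by blast
    ultimately show ?thesis
      using subspace_crown_bot[OF AB(1)] by (metis complement_mod_unique)
  qed
  then have "U = (\<Inter>CR\<in>crowns. \<Inter>i\<in>{i\<in>I. cr i = CR}. Ms i)" using U by simp
  also have "\<dots> = (\<Inter>i\<in>I. Ms i)" using crI by blast
  finally show "prefrattini U"
    unfolding prefrattini_def using ser Ms unfolding I_def by blast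
qed

end

theorem theorem3p6:
  fixes scale :: "'f::field \<Rightarrow> 'v::ab_group_add \<Rightarrow> 'v"
    and br :: "'v \<Rightarrow> 'v \<Rightarrow> 'v"
  assumes "lie_algebra scale br"
    and "lie_algebra.fin_dim scale"
    and "lie_algebra.solvable scale br"
  shows "lie_algebra.prefrattini scale br U \<longleftrightarrow>
    (\<exists>K. (\<forall>CR\<in>lie_algebra.crowns scale br.
            lie_algebra.complement_mod scale br (K CR) (fst CR) (snd CR)) \<and>
         U = (\<Inter>CR\<in>lie_algebra.crowns scale br. K CR))"
proof -
  interpret lie_algebra scale br by (rule assms(1))
  interpret solvable_lie_algebra scale br
    using assms(2,3) by unfold_locales
  show ?thesis by (rule prefrattini_iff_crown_complements)
qed

end
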